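(* Let $A$ be an alphabet with $l>1$ letters, and let $\mathbf{s}=(i_r,\ldots,i_2,i_1)$ be a strictly increasing sequence of positive integers, i.e. $1\le i_r<i_{r-1}<\cdots<i_2<i_1$. 1) If $r<l$, then there are no dead-ends for $(A,\mathbf{s})$. 2) Suppose $r=l$. If $i_r\ge 2$, then there are no dead-ends for $(A,\mathbf{s})$ if and only if either $\mathbf{s}=(i_r,2i_r,\ldots,2^{r-1}i_r)$ or there is an integer $t$ with $0<t<r-1$ such that $i_t\le i_{t+1}+\cdots+i_r$. If $i_r=1$, then these conditions are sufficient: if either $\mathbf{s}=(i_r,2i_r,\ldots,2^{r-1}i_r)$ or there is an integer $t$ with $0<t<r-1$ such that $i_t\le i_{t+1}+\cdots+i_r$, then there are no dead-ends for $(A,\mathbf{s})$. 3) Suppose $r>l$. If every subsequence $\mathbf{s}'=(i_{j_l},\ldots,i_{j_2},i_{j_1})$ of $\mathbf{s}$ of length $l$ (with $i_{j_l}<\cdots<i_{j_2}<i_{j_1}$) is either of the form $(i_{j_l},2i_{j_l},\ldots,2^{l-1}i_{j_l})$ or satisfies $i_{j_t}\le i_{j_{t+1}}+\cdots+i_{j_l}$ for some integer $t$ with $0<t<l-1$, then there are no dead-ends for $(A,\mathbf{s})$.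
   Context: A word over $A$ is a finite sequence of letters of $A$. For a positive integer $i$, a word is $i$-squarefree if it cannot be written as $xvvy$ with $x,v,y$ words (with $x,y$ possibly empty) and $|v|=i$. For $\mathbf{s}=(i_r,\ldots,i_1)$, a word is $\mathbf{s}$-squarefree if it is $i_t$-squarefree for every $t=1,\ldots,r$. Put $N=2i_1$. A dead-end for $(A,\mathbf{s})$ is an $\mathbf{s}$-squarefree word $w=w_1w_2\cdots w_N$ over $A$ of length $N$ such that for every letter $a\in A$ the word $w_2\cdots w_{N}a$ has a suffix of the form $vv$ with $|v|=i_t$ for some $t\in\{1,\ldots,r\}$ (that is, appending any letter to $w$ creates a forbidden square). In the paper, "the sequential method has no dead-ends" means that no such word exists. *)

theory Defs
  imports Main
begin

text \<open>
  A sequence \<open>(i\<^sub>r, \<dots>, i\<^sub>2, i\<^sub>1)\<close> is given by its length \<open>r\<close> and a function \<open>i\<close>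
  on indices; only the values \<open>i 1, \<dots>, i r\<close> are relevant. As in the source the
  indexing is decreasing, so \<open>i r\<close> is the first (smallest) and \<open>i 1\<close> the last
  (largest) entry.
\<close>

definition increasing_seq :: "nat \<Rightarrow> (nat \<Rightarrow> nat) \<Rightarrow> bool" where
  "increasing_seq r i \<longleftrightarrow>
     1 \<le> r \<and> (\<forall>t\<in>{1..r}. 1 \<le> i t) \<and> (\<forall>t. 1 \<le> t \<and> t < r \<longrightarrow> i (t + 1) < i t)"

definition squarefree_len :: "nat \<Rightarrow> 'a list \<Rightarrow> bool" where
  "squarefree_len m w \<longleftrightarrow> \<not> (\<exists>x v y. w = x @ v @ v @ y \<and> length v = m)"

definition squarefree_seq :: "nat \<Rightarrow> (nat \<Rightarrow> nat) \<Rightarrow> 'a list \<Rightarrow> bool" where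
  "squarefree_seq r i w \<longleftrightarrow> (\<forall>t\<in>{1..r}. squarefree_len (i t) w)"

definition dead_end :: "'a set \<Rightarrow> nat \<Rightarrow> (nat \<Rightarrow> nat) \<Rightarrow> 'a list \<Rightarrow> bool" where
  "dead_end A r i w \<longleftrightarrow>
     set w \<subseteq> A \<and> length w = 2 * i 1 \<and> squarefree_seq r i w \<and>
     (\<forall>a\<in>A. \<exists>t\<in>{1..r}. \<exists>x v. tl w @ [a] = x @ v @ v \<and> length v = i t)"

definition no_dead_ends :: "'a set \<Rightarrow> nat \<Rightarrow> (nat \<Rightarrow> nat) \<Rightarrow> bool" where
  "no_dead_ends A r i \<longleftrightarrow> \<not> (\<exists>w. dead_end A r i w)"

text \<open>The sequence is \<open>(i\<^sub>r, 2 i\<^sub>r, \<dots>, 2\<^sup>r\<^sup>-\<^sup>1 i\<^sub>r)\<close>.\<close>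

definition doubling_seq :: "nat \<Rightarrow> (nat \<Rightarrow> nat) \<Rightarrow> bool" where
  "doubling_seq r i \<longleftrightarrow> (\<forall>t\<in>{1..r}. i t = 2 ^ (r - t) * i r)"

definition has_small_term :: "nat \<Rightarrow> (nat \<Rightarrow> nat) \<Rightarrow> bool" where
  "has_small_term r i \<longleftrightarrow> (\<exists>t. 0 < t \<and> t < r - 1 \<and> i t \<le> (\<Sum>u = t + 1..r. i u))"

text \<open>
  A choice \<open>1 \<le> j 1 < \<dots> < j l \<le> r\<close> of indices; the corresponding subsequence
  \<open>(i (j l), \<dots>, i (j 1))\<close> is given by \<open>l\<close> and \<open>\<lambda>k. i (j k)\<close>.
\<close>

definition index_choice :: "nat \<Rightarrow> nat \<Rightarrow> (nat \<Rightarrow> nat) \<Rightarrow> bool" where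
  "index_choice l r j \<longleftrightarrow> j ` {1..l} \<subseteq> {1..r} \<and> strict_mono_on {1..l} j"

end

(*
  Read the word w backwards, p z being its z-th letter from the end. Appending a creates a square
  of length m iff p m = a and p z = p (z - m) for m < z < 2 m. In a dead end l of the lengths
  thus carry distinct letters ("marks"). Cutting at the largest remaining mark m turns every mark
  x < 2 m into a mark x - m inside {1..m}; a Fine-Wilf argument with marks as exceptional positions
  shows that these stay above the remaining lengths, so each length exceeds the sum of the smaller
  ones. For a doubling sequence p is a ruler word, and the first letter of w would close a square.
  Conversely, undoing the cuts one length at a time builds p. Free positions 2 m <= z < Min X are
  filled greedily, avoiding p (z - u) for every remaining length u; one such constraint is dropped
  where the letter must also differ from that of Min X, which is harmless because all lengths are
  at least 2. The first letter of w is chosen last; it exists because the sequence is not doubling.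
*)

theory Submission
  imports Defs
begin

subsection \<open>Periods with exceptional positions\<close>

text \<open>\<open>copies X p\<close> says that the word restarts from position 1 after each mark,
  so it is fixed by its letters at the marks and below the least mark. A period \<open>m\<close>
  identifies the stretch after \<open>m\<close> with the one before it; hence \<open>x - m\<close>
  inherits the letter of \<open>x\<close>, while \<open>m\<close> turns into a mark with its own
  letter. Marks accumulate, which is why both directions speak of sets of marks although they start
  from a single one. Absence of squares alone does not survive undoing a cut: a restart at a mark
  \<open>x < 2 * m\<close> is, one level down, a restart at \<open>m\<close> followed by one at
  \<open>x - m\<close>. The induction therefore carries \<open>tiles_squarefree\<close>, about all
  concatenations of marked prefixes. The greedy filling is tight: n remaining lengths impose n
  mismatches on a choice among n + 1 letters, those of the lengths and that of the least mark. A
  further demand on a letter is affordable only if one mismatch is given up. Doubling is exceptional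
  because, for a single mark \<open>y\<close>, exactly \<open>y = 2 * m\<close> leaves neither a
  free position below \<open>y\<close> nor a mark \<open>y - m\<close>, and passes the choice of the
  first letter on to the next length.\<close>

definition copies :: "nat set \<Rightarrow> (nat \<Rightarrow> 'a) \<Rightarrow> nat \<Rightarrow> bool" where
  "copies X p z \<longleftrightarrow> (\<forall>x\<in>X. x < z \<longrightarrow> (\<forall>x'\<in>X. x' < z \<longrightarrow> x' \<le> x) \<longrightarrow> p z = p (z - x))"

lemma copiesD:
  assumes "copies X p z" "x \<in> X" "x < z" "\<And>x'. x' \<in> X \<Longrightarrow> x' < z \<Longrightarrow> x' \<le> x"
  shows "p z = p (z - x)"
  using assms by (auto simp: copies_def)

lemma copiesI:
  assumes "\<And>x. x \<in> X \<Longrightarrow> x < z \<Longrightarrow> (\<And>x'. x' \<in> X \<Longrightarrow> x' < z \<Longrightarrow> x' \<le> x) \<Longrightarrow> p z = p (z - x)"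
  shows "copies X p z"
  using assms by (auto simp: copies_def)

lemma max_below:
  fixes X :: "nat set"
  assumes "y \<in> X" "y < z"
  obtains x where "x \<in> X" "x < z" "\<And>x'. x' \<in> X \<Longrightarrow> x' < z \<Longrightarrow> x' \<le> x"
proof -
  let ?S = "{x \<in> X. x < z}"
  have f: "finite ?S" by (rule finite_subset[of _ "{..<z}"]) auto
  have "Max ?S \<in> ?S" using f assms by (intro Max_in) auto
  then show ?thesis using that[of "Max ?S"] f by auto
qed

text \<open>
  A Fine--Wilf statement by a Euclidean descent on \<open>y + a\<close>: depending on where \<open>a\<close> lies among the
  marks, subtract \<open>a\<close> from all marks, or subtract from \<open>a\<close> the largest mark \<open>k\<close> below it. When the
  next mark above \<open>a\<close> is farther than \<open>y\<close> from \<open>k\<close>, the word itself has to be shifted by \<open>k\<close>.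
\<close>

lemma mark_clash:
  fixes p :: "nat \<Rightarrow> 'a"
  assumes "y \<in> X" "\<And>x. x \<in> X \<Longrightarrow> y \<le> x" "0 < y" "0 < a"
    and "\<And>z. z < y + a \<Longrightarrow> z \<notin> X \<Longrightarrow> copies X p z"
    and "\<And>z. a < z \<Longrightarrow> z < y + a \<Longrightarrow> p z = p (z - a)"
    and "\<And>x. x \<in> X \<Longrightarrow> x < y + a \<Longrightarrow> p x \<noteq> p a"
  shows False
  using assms
proof (induction "y + a" arbitrary: y a X p rule: less_induct)
  case less
  note ymin = less.prems(2) and cop = less.prems(5) and per = less.prems(6) and sep = less.prems(7)
  have aX: "a \<notin> X" using sep[of a] less.prems(3) by auto
  consider "a < y" | "y < a" using less.prems(1) aX by (cases a y rule: linorder_cases) auto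
  then show False
  proof cases
    case 1
    show False
    proof (rule less.hyps[of "y - a" a "(\<lambda>x. x - a) ` X" p])
      fix z assume z: "z < y - a + a" "z \<notin> (\<lambda>x. x - a) ` X"
      show "copies ((\<lambda>x. x - a) ` X) p z"
      proof (rule copiesI)
        fix x' assume x': "x' \<in> (\<lambda>x. x - a) ` X" "x' < z"
          and m: "\<And>x''. x'' \<in> (\<lambda>x. x - a) ` X \<Longrightarrow> x'' < z \<Longrightarrow> x'' \<le> x'"
        obtain x where x: "x \<in> X" "x' = x - a" using x' by auto
        have ax: "a < x" using ymin[OF x(1)] 1 by simp
        have "z + a \<notin> X" using z(2) by (metis add_diff_cancel_right' image_eqI)
        moreover have "z + a < y + a" using z(1) 1 by simp
        ultimately have c: "copies X p (z + a)" using cop by simp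
        have "p (z + a) = p (z + a - x)"
        proof (rule copiesD[OF c x(1)])
          show "x < z + a" using x x' ax by simp
          fix e assume e: "e \<in> X" "e < z + a"
          have "a < e" using ymin[OF e(1)] 1 by simp
          then show "e \<le> x" using m[of "e - a"] e x ax by force
        qed
        moreover have "p (z + a) = p z" using per[of "z + a"] z(1) x'(2) 1 by simp
        moreover have "z + a - x = z - x'" using x ax by simp
        ultimately show "p z = p (z - x')" by simp
      qed
    next
      fix x' assume x': "x' \<in> (\<lambda>x. x - a) ` X" "x' < y - a + a"
      then obtain x where x: "x \<in> X" "x' = x - a" by auto
      have "a < x" using ymin[OF x(1)] 1 by simp
      then show "p x' \<noteq> p a" using per[of x] sep[of x] x x' 1 by auto
    next
      show "y - a \<in> (\<lambda>x. x - a) ` X" using less.prems(1) by blast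
      show "y - a \<le> x'" if "x' \<in> (\<lambda>x. x - a) ` X" for x'
        using that ymin by (auto intro: diff_le_mono)
      show "p z = p (z - a)" if "a < z" "z < y - a + a" for z
        using per[of z] that 1 by simp
    qed (use 1 less.prems(4) in auto)
  next
    case 2
    obtain k where k: "k \<in> X" "k < a" and kmax: "\<And>x. x \<in> X \<Longrightarrow> x < a \<Longrightarrow> x \<le> k"
      using max_below[OF less.prems(1) 2] by metis
    have yk: "y \<le> k" using ymin k by simp
    have pa: "p a = p (a - k)"
      by (rule copiesD[OF cop[OF _ aX]]) (use k kmax less.prems(3) in auto)
    show False
    proof (cases "\<exists>x\<in>X. a < x \<and> x \<le> k + y")
      case True
      define x where "x = (LEAST x. x \<in> X \<and> a < x)"
      have x: "x \<in> X" "a < x" using LeastI_ex[of "\<lambda>x. x \<in> X \<and> a < x"] True by (auto simp: x_def)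
      have xl: "x \<le> e" if "e \<in> X" "a < e" for e using that by (auto simp: x_def intro: Least_le)
      have xk: "x \<le> k + y" using True xl by force
      have sum: "x - a + (a - k) = x - k" using x k by simp
      \<comment> \<open>The new period is \<open>a - k\<close>: a position \<open>z + k\<close>
        strictly between \<open>a\<close> and \<open>x\<close> has \<open>k\<close> as its largest
        mark below, so \<open>p (z + k)\<close> equals both \<open>p z\<close> and
        \<open>p (z + k - a)\<close>. The new sum is \<open>x - k\<close>, at most
        \<open>y\<close>.\<close>
      show False
      proof (rule less.hyps[of "x - a" "a - k" "{e - a | e. e \<in> X \<and> a < e}" p])
        fix z assume z: "z < x - a + (a - k)" "z \<notin> {e - a | e. e \<in> X \<and> a < e}"
        show "copies {e - a | e. e \<in> X \<and> a < e} p z"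
        proof (rule copiesI)
          fix x' assume x': "x' \<in> {e - a | e. e \<in> X \<and> a < e}" "x' < z"
            and m: "\<And>x''. x'' \<in> {e - a | e. e \<in> X \<and> a < e} \<Longrightarrow> x'' < z \<Longrightarrow> x'' \<le> x'"
          obtain e where e: "e \<in> X" "a < e" "x' = e - a" using x' by auto
          have "z + a \<notin> X" using z(2) x'(2) by force
          moreover have zy: "z + a < y + a" using z(1) sum xk by simp
          ultimately have c: "copies X p (z + a)" using cop by simp
          have "p (z + a) = p (z + a - e)"
          proof (rule copiesD[OF c e(1)])
            show "e < z + a" using e x' by simp
            fix f assume f: "f \<in> X" "f < z + a"
            show "f \<le> e"
            proof (cases "a < f")
              case True
              then show ?thesis using m[of "f - a"] f e by force
            qed (use e in simp)
          qed
          moreover have "p (z + a) = p z" using per[of "z + a"] zy x'(2) by simp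
          moreover have "z + a - e = z - x'" using e by simp
          ultimately show "p z = p (z - x')" by simp
        qed
      next
        fix z assume z: "a - k < z" "z < x - a + (a - k)"
        have b: "a < z + k" "z + k < x" "z + k < y + a" using z sum k xk by auto
        have "z + k \<notin> X" using xl b by force
        then have c: "copies X p (z + k)" using cop b by simp
        have "p (z + k) = p (z + k - k)"
        proof (rule copiesD[OF c k(1)])
          show "k < z + k" using z by simp
          fix f assume f: "f \<in> X" "f < z + k"
          then have "f < a" using xl[of f] aX b by (metis leD less_trans nat_neq_iff)
          then show "f \<le> k" using kmax f by simp
        qed
        then show "p z = p (z - (a - k))" using per[of "z + k"] b k by (simp add: add.commute)
      next
        fix x' assume x': "x' \<in> {e - a | e. e \<in> X \<and> a < e}" "x' < x - a + (a - k)"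
        then obtain e where e: "e \<in> X" "a < e" "x' = e - a" by auto
        then have "e < y + a" using x' sum xk by simp
        then show "p x' \<noteq> p (a - k)" using per[of e] sep[of e] e pa by simp
      next
        show "x - a \<in> {e - a | e. e \<in> X \<and> a < e}" using x by blast
        show "x - a \<le> x'" if "x' \<in> {e - a | e. e \<in> X \<and> a < e}" for x'
          using that xl by (auto intro: diff_le_mono)
        show "x - a + (a - k) < y + a" using sum xk k by linarith
        show "0 < x - a" "0 < a - k" using x k by auto
      qed
    next
      case False
      \<comment> \<open>As long as \<open>z + k\<close> stays below the next mark above
        \<open>a\<close>, \<open>q\<close> agrees with \<open>p\<close> (\<open>qp\<close>), so its
        marks there are those of \<open>p\<close>; beyond, they are the marks of \<open>p\<close>
        moved down by \<open>k\<close>. Since no mark lies above \<open>a\<close> and up to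
        \<open>k + y\<close>, \<open>P y\<close> holds: \<open>y\<close> stays the least mark while
        \<open>a\<close> drops to \<open>a - k\<close>.\<close>
      define P where "P z \<longleftrightarrow> (\<forall>x\<in>X. a < x \<longrightarrow> z + k < x)" for z
      define q where "q z = p (z + k)" for z
      define X' where "X' = {z. if P z then z \<in> X else z + k \<in> X}"
      have Pmono: "P z" if "P z'" "z \<le> z'" for z z' using that by (force simp: P_def)
      have Py: "P y" using False by (force simp: P_def)
      have qp: "q z = p z" if "P z" "0 < z" "z + k < y + a" for z
      proof -
        have lek: "f \<le> k" if "f \<in> X" "f < z + k \<or> f = z + k" for f
        proof -
          have "\<not> a < f" using that \<open>P z\<close> by (auto simp: P_def)
          then have "f < a" using aX that by (metis nat_neq_iff)
          then show ?thesis using kmax that by simp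
        qed
        have "z + k \<notin> X" using lek[of "z + k"] that by auto
        then have c: "copies X p (z + k)" using cop that(3) by blast
        have "p (z + k) = p (z + k - k)"
          by (rule copiesD[OF c k(1)]) (use lek that(2) in auto)
        then show ?thesis by (simp add: q_def)
      qed
      show False
      proof (rule less.hyps[of y "a - k" X' q])
        show "y + (a - k) < y + a" using k yk less.prems(3) by simp
        show "y \<in> X'" using Py less.prems(1) by (simp add: X'_def)
        show "y \<le> x" if "x \<in> X'" for x
        proof (cases "P x")
          case True
          then show ?thesis using that ymin by (simp add: X'_def)
        next
          case False
          then show ?thesis using Pmono[OF Py, of x] by linarith
        qed
        show "0 < y" "0 < a - k" using less.prems(3) k by auto
        show "q x \<noteq> q (a - k)" if "x \<in> X'" "x < y + (a - k)" for x
        proof (cases "P x")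
          case True
          then have "x \<in> X" using that by (simp add: X'_def)
          moreover have "0 < x" using ymin[OF calculation] less.prems(3) by simp
          ultimately show ?thesis using True that qp[of x] sep[of x] k by (simp add: q_def)
        next
          case False
          then show ?thesis using that sep[of "x + k"] k by (simp add: q_def X'_def)
        qed
        show "q z = q (z - (a - k))" if z: "a - k < z" "z < y + (a - k)" for z
        proof -
          have b: "a < z + k" "z + k < y + a" "z + k - a < y" using z k by auto
          have "q z = p (z + k - a)" using per b by (simp add: q_def)
          also have "\<dots> = q (z + k - a)" using qp[of "z + k - a"] Pmono[OF Py] b k by simp
          finally show ?thesis using k by (simp add: add.commute)
        qed
        fix z assume z: "z < y + (a - k)" "z \<notin> X'"
        show "copies X' q z"
        proof (rule copiesI)
          fix x' assume x': "x' \<in> X'" "x' < z" and m: "\<And>x''. x'' \<in> X' \<Longrightarrow> x'' < z \<Longrightarrow> x'' \<le> x'"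
          show "q z = q (z - x')"
          proof (cases "P z")
            case True
            then have zX: "z \<notin> X" using z by (simp add: X'_def)
            have "P x'" using Pmono True x' by simp
            then have xX: "x' \<in> X" using x' by (simp add: X'_def)
            have "p z = p (z - x')"
            proof (rule copiesD[OF cop[OF _ zX] xX x'(2)])
              show "z < y + a" using z by simp
              fix f assume f: "f \<in> X" "f < z"
              then have "f \<in> X'" using Pmono[OF True, of f] by (simp add: X'_def)
              then show "f \<le> x'" using m f by simp
            qed
            moreover have "q z = p z" using qp[of z] True z x' k by simp
            moreover have "q (z - x') = p (z - x')" using qp[of "z - x'"] Pmono[OF True, of "z - x'"] z x' k by simp
            ultimately show ?thesis by simp
          next
            case False
            then have zX: "z + k \<notin> X" using z by (simp add: X'_def)
            have high: "f - k \<in> X'" "k < f" if "f \<in> X" "a < f" for f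
            proof -
              show kf: "k < f" using that k by simp
              then have "\<not> P (f - k)" using that by (auto simp: P_def)
              then show "f - k \<in> X'" using that kf by (simp add: X'_def)
            qed
            obtain x0 where x0: "x0 \<in> X" "a < x0" "x0 \<le> z + k" using False by (auto simp: P_def not_less)
            have "x0 < z + k" using x0 zX by (metis nat_less_le)
            then have x0': "x0 - k \<le> x'" using m[OF high(1)[OF x0(1,2)]] high(2)[OF x0(1,2)] by simp
            then have "\<not> P x'" using x0 by (auto simp: P_def)
            then have xX: "x' + k \<in> X" using x' by (simp add: X'_def)
            have "p (z + k) = p (z + k - (x' + k))"
            proof (rule copiesD[OF cop[OF _ zX] xX])
              show "z + k < y + a" "x' + k < z + k" using z x' k by auto
              fix f assume f: "f \<in> X" "f < z + k"
              show "f \<le> x' + k"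
              proof (cases "a < f")
                case True
                have "k < f" by (rule high(2)[OF f(1) True])
                moreover from this have "f - k < z" using f by linarith
                ultimately show ?thesis using m[OF high(1)[OF f(1) True]] by linarith
              next
                case False
                then have "f < a" using aX f by (metis nat_neq_iff)
                then show ?thesis using kmax f by (simp add: trans_le_add2)
              qed
            qed
            moreover have "z - x' < y" using x0' x0 z k by simp
            then have "q (z - x') = p (z - x')" using qp[of "z - x'"] Pmono[OF Py, of "z - x'"] x' k by simp
            ultimately show ?thesis by (simp add: q_def)
          qed
        qed
      qed
    qed
  qed
qed

text \<open>Induction on \<open>T\<close>. After the cut at the head \<open>m\<close>, the induction
  hypothesis puts the sum of the tail below \<open>m\<close> and below every \<open>x - m\<close>
  with \<open>x < 2 * m\<close>; adding \<open>m\<close> gives the claim for these \<open>x\<close>,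
  and for \<open>x \<ge> 2 * m\<close> the bound on \<open>m\<close> is enough.\<close>

lemma marks_above_sum:
  fixes p :: "nat \<Rightarrow> 'a"
  assumes "sorted_wrt (>) T" "\<And>t. t \<in> set T \<Longrightarrow> 0 < t"
    and "\<And>x. x \<in> X \<Longrightarrow> 0 < x" "\<And>x t. x \<in> X \<Longrightarrow> t \<in> set T \<Longrightarrow> t < x"
    and "\<And>t z. t \<in> set T \<Longrightarrow> z < 2 * t \<Longrightarrow> z \<notin> X \<Longrightarrow> copies X p z"
    and "\<And>t z. t \<in> set T \<Longrightarrow> t < z \<Longrightarrow> z < 2 * t \<Longrightarrow> p z = p (z - t)"
    and "inj_on p (set T)" "\<And>x t. x \<in> X \<Longrightarrow> t \<in> set T \<Longrightarrow> p x \<noteq> p t"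
    and "x \<in> X"
  shows "sum_list T < x"
  using assms
proof (induction T arbitrary: X x)
  case Nil
  then show ?case by (metis sum_list.Nil)
next
  case (Cons m T)
  note cop = Cons.prems(5) and per = Cons.prems(6)
  define X' where "X' = insert m {x - m | x. x \<in> X \<and> x < 2 * m}"
  have mX: "m < x" if "x \<in> X" for x using Cons.prems(4) that by simp
  have Tm: "t < m" if "t \<in> set T" for t using Cons.prems(1) that by simp
  have le: "x \<le> m" if "x \<in> X'" for x using that by (auto simp: X'_def)
  have pos: "0 < x" if "x \<in> X'" for x using that Cons.prems(2) mX by (auto simp: X'_def)
  have copX': "copies X' p z" if z: "z < 2 * m" "z \<notin> X'" for z
  proof (rule copiesI)
    fix x' assume x': "x' \<in> X'" "x' < z" and mx: "\<And>e. e \<in> X' \<Longrightarrow> e < z \<Longrightarrow> e \<le> x'"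
    show "p z = p (z - x')"
    proof (cases "z < m")
      case True
      then obtain x where x: "x \<in> X" "x < 2 * m" "x' = x - m" using x' by (auto simp: X'_def)
      have xm: "m < x" using mX x by simp
      have zX: "z + m \<notin> X"
      proof
        assume "z + m \<in> X"
        then have "z \<in> X'" using True unfolding X'_def by (intro insertI2 CollectI exI[of _ "z + m"]) simp
        then show False using z by simp
      qed
      have "p (z + m) = p (z + m - x)"
      proof (rule copiesD[OF cop[of m, OF _ _ zX] x(1)])
        show "m \<in> set (m # T)" "z + m < 2 * m" "x < z + m" using True x x' xm by auto
        fix f assume f: "f \<in> X" "f < z + m"
        then have "f - m \<in> X'" "m < f" using True mX by (auto simp: X'_def)
        moreover have "f - m < z" using f calculation by linarith
        ultimately show "f \<le> x" using mx[of "f - m"] x xm by linarith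
      qed
      moreover have "p (z + m) = p z" using per[of m "z + m"] True x' by simp
      ultimately show ?thesis using x xm by simp
    next
      case False
      have "m \<noteq> z" using z by (auto simp: X'_def)
      with False have "m < z" by simp
      moreover from this have "x' = m" using mx[of m] le[OF x'(1)] by (simp add: X'_def)
      ultimately show ?thesis using per[of m z] z by simp
    qed
  qed
  have sep: "p x' \<noteq> p t" if xt: "x' \<in> X'" "t \<in> set T" for x' t
  proof (cases "x' = m")
    case True
    then show ?thesis using inj_onD[OF Cons.prems(7), of m t] that Tm[of t] by auto
  next
    case False
    then obtain x where x: "x \<in> X" "x < 2 * m" "x' = x - m" using xt by (auto simp: X'_def)
    then have "p x = p x'" using per[of m x] mX by simp
    then show ?thesis using Cons.prems(8)[of x t] x that by simp
  qed
  \<comment> \<open>Otherwise some mark is at most \<open>t\<close>, and not equal to it since their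
    letters differ. Then the least mark \<open>y\<close> satisfies \<open>y + t < 2 * t\<close>, so
    copying and the period \<open>t\<close> reach far enough for \<open>mark_clash\<close>.\<close>
  have above: "t < x'" if t: "t \<in> set T" and x': "x' \<in> X'" for x' t
  proof (rule ccontr)
    assume "\<not> t < x'"
    then have xt: "x' < t" using sep[OF x' t] by (cases "x' = t") auto
    define y where "y = (LEAST e. e \<in> X')"
    have y: "y \<in> X'" using LeastI[of "\<lambda>e. e \<in> X'"] x' by (simp add: y_def)
    have yl: "y \<le> e" if "e \<in> X'" for e using that by (simp add: y_def Least_le)
    have yt: "y < t" using yl[OF x'] xt by simp
    show False
    proof (rule mark_clash[OF y yl pos[OF y], of t p])
      show "0 < t" using xt by simp
      show "copies X' p z" if "z < y + t" "z \<notin> X'" for z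
        by (rule copX') (use that yt Tm[OF t] in auto)
      show "p z = p (z - t)" if "t < z" "z < y + t" for z
        using per[of t z] t that yt by simp
      show "p e \<noteq> p t" if "e \<in> X'" for e using sep that t by simp
    qed
  qed
  have IH: "sum_list T < x'" if "x' \<in> X'" for x'
  proof (rule Cons.IH[of X' x'])
    show "copies X' p z" if "t \<in> set T" "z < 2 * t" "z \<notin> X'" for t z
      using copX'[of z] that Tm[of t] by simp
    show "inj_on p (set T)" using Cons.prems(7) by (simp add: inj_on_def)
    show "p z = p (z - t)" if "t \<in> set T" "t < z" "z < 2 * t" for t z
      using per[of t z] that by simp
    show "sorted_wrt (>) T" using Cons.prems(1) by simp
    show "0 < t" if "t \<in> set T" for t using Cons.prems(2) that by simp
  qed (blast intro: pos above that dest: sep)+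
  have sm: "sum_list T < m" using IH by (simp add: X'_def)
  show ?case
  proof (cases "x < 2 * m")
    case True
    then have "x - m \<in> X'" using Cons.prems(9) by (auto simp: X'_def)
    then show ?thesis using IH[of "x - m"] by simp
  qed (use sm in simp)
qed

subsection \<open>Dead ends force an unexceptional subsequence\<close>

lemma increasing_seq_less:
  assumes "increasing_seq r i" "1 \<le> s" "s < t" "t \<le> r"
  shows "i t < i s"
  using assms(3,4)
proof (induction t)
  case (Suc t)
  then have "i (Suc t) < i t" using assms(1,2) by (auto simp: increasing_seq_def)
  then show ?case using Suc by (cases "s = t") auto
qed simp

text \<open>A small term contradicts \<open>marks_above_sum\<close> with the single mark
  \<open>k t\<close> and the lengths after it. In a doubling sequence the periods compose: if the
  letter at \<open>2 * k 1\<close> is that of \<open>k s\<close>, the \<open>2 * k s\<close>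
  positions up to \<open>2 * k 1\<close> form a square of length \<open>k s\<close>, against
  \<open>sqf\<close>.\<close>

lemma marked_system_not_exceptional:
  fixes p :: "nat \<Rightarrow> 'a" and k :: "nat \<Rightarrow> nat"
  assumes seq: "increasing_seq l k"
    and per: "\<And>t z. t \<in> {1..l} \<Longrightarrow> k t < z \<Longrightarrow> z < 2 * k t \<Longrightarrow> p z = p (z - k t)"
    and inj: "inj_on (\<lambda>t. p (k t)) {1..l}"
    and last: "p (2 * k 1) \<in> (\<lambda>t. p (k t)) ` {1..l}"
    and sqf: "\<And>s. s \<in> {1..l} \<Longrightarrow> \<exists>j\<in>{1..k s}. p (2 * k 1 - 2 * k s + j) \<noteq> p (2 * k 1 - k s + j)"
  shows "\<not> doubling_seq l k" "\<not> has_small_term l k"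
proof -
  have pos: "0 < k t" if "t \<in> {1..l}" for t using seq that by (force simp: increasing_seq_def)
  note dec = increasing_seq_less[OF seq]
  show "\<not> has_small_term l k"
  proof
    assume "has_small_term l k"
    then obtain t where t: "0 < t" "t < l - 1" "k t \<le> (\<Sum>u = t + 1..l. k u)"
      by (auto simp: has_small_term_def)
    define T where "T = map k [t + 1..<Suc l]"
    have setT: "set T = k ` {t + 1..l}" unfolding T_def by (simp add: atLeastLessThanSuc_atLeastAtMost del: upt_Suc)
    have "sum_list T < k t"
    proof (rule marks_above_sum[of T "{k t}" p])
      have "sorted_wrt (\<lambda>s u. k u < k s) [t + 1..<Suc l]"
        by (rule sorted_wrt_mono_rel[OF _ sorted_wrt_upt]) (use dec in auto)
      then show "sorted_wrt (>) T" by (simp add: T_def sorted_wrt_map del: upt_Suc)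
      show "0 < u" if "u \<in> set T" for u using that pos t(1) by (auto simp: setT)
      show "u < x" if "x \<in> {k t}" "u \<in> set T" for x u using that dec t by (auto simp: setT)
      show "copies {k t} p z" if "u \<in> set T" "z < 2 * u" for u z
      proof (rule copiesI)
        fix x assume "x \<in> {k t}" "x < z"
        moreover have "u < k t" using that dec t by (auto simp: setT)
        ultimately show "p z = p (z - x)" using per[of t z] that t by simp
      qed
      show "p z = p (z - u)" if u: "u \<in> set T" "u < z" "z < 2 * u" for u z
      proof -
        obtain v where v: "v \<in> {t + 1..l}" "u = k v" using u(1) by (auto simp: setT)
        then show ?thesis using per[of v z] u(2,3) by simp
      qed
      show "inj_on p (set T)"
        unfolding setT using inj_on_subset[OF inj, of "{t + 1..l}"]
        by (intro inj_on_imageI) (simp add: comp_def subset_eq)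
      show "p x \<noteq> p u" if xu: "x \<in> {k t}" "u \<in> set T" for x u
      proof -
        obtain v where "v \<in> {t + 1..l}" "u = k v" using xu by (auto simp: setT)
        then show ?thesis using inj_onD[OF inj, of t v] t xu by auto
      qed
    qed (use pos t in auto)
    moreover have "sum_list T = (\<Sum>u = t + 1..l. k u)"
      by (simp add: T_def interv_sum_list_conv_sum_set_nat atLeastLessThanSuc_atLeastAtMost del: upt_Suc)
    ultimately show False using t by simp
  qed
  show "\<not> doubling_seq l k"
  proof
    assume d: "doubling_seq l k"
    have dbl: "k t = 2 * k (Suc t)" if "1 \<le> t" "t < l" for t
    proof -
      have "k t = 2 ^ (l - t) * k l" "k (Suc t) = 2 ^ (l - Suc t) * k l"
        by (rule bspec[OF d[unfolded doubling_seq_def]]; use that in simp)+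
      moreover have "l - t = Suc (l - Suc t)" using that by simp
      ultimately show ?thesis by simp
    qed
    obtain s where s: "s \<in> {1..l}" "p (2 * k 1) = p (k s)" using last by auto
    \<comment> \<open>The period \<open>k t\<close> leads to \<open>k t - 2 * k s + y\<close>, the
      same expression for \<open>Suc t\<close> because \<open>k t = 2 * k (Suc t)\<close>. The bound
      on \<open>y\<close> is strict since the period \<open>k t\<close> does not reach position
      \<open>2 * k t\<close>; the letter at \<open>2 * k 1\<close> is known from the choice of
      \<open>s\<close> instead.\<close>
    have red: "p (2 * k t - 2 * k s + y) = p y \<and> k s \<le> k t"
      if y: "0 < y" "y < 2 * k s" and t: "1 \<le> t" "t \<le> s" for y t
      using t(2,1)
    proof (induction t rule: inc_induct)
      case base
      then show ?case by simp
    next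
      case (step t)
      let ?z = "2 * k t - 2 * k s + y"
      have kt: "k t = 2 * k (Suc t)" using dbl[of t] step s by simp
      have le: "k s \<le> k (Suc t)" using step.IH by simp
      have "?z - k t = 2 * k (Suc t) - 2 * k s + y" using kt le by simp
      moreover have "k t < ?z" "?z < 2 * k t" using kt le y by auto
      ultimately have "p ?z = p (2 * k (Suc t) - 2 * k s + y)" using per[of t ?z] step s by simp
      also have "\<dots> = p y" by (rule step.IH[THEN conjunct1]) simp
      finally show ?case using kt le by simp
    qed
    obtain j where j: "j \<in> {1..k s}" "p (2 * k 1 - 2 * k s + j) \<noteq> p (2 * k 1 - k s + j)"
      using sqf[OF s(1)] by auto
    have ps: "0 < k s" using pos s by simp
    have le: "k s \<le> k 1" using red[of 1 1] s ps by simp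
    have a: "p (2 * k 1 - 2 * k s + j) = p j" using red[of j 1] j s by auto
    show False
    proof (cases "j = k s")
      case True
      then show False using a j s le by (simp add: algebra_simps)
    next
      case False
      have "2 * k 1 - k s + j = 2 * k 1 - 2 * k s + (k s + j)" using le by simp
      then have "p (2 * k 1 - k s + j) = p (2 * k 1 - 2 * k s + (k s + j))" by (rule arg_cong)
      also have "\<dots> = p (k s + j)"
        by (rule red[THEN conjunct1]) (use j s False in auto)
      also have "\<dots> = p j" using per[of s "k s + j"] j s False by simp
      finally show False using a j by simp
    qed
  qed
qed

section \<open>Suffix squares, and the marked system inside a dead end\<close>

definition suffix_square :: "nat \<Rightarrow> 'a list \<Rightarrow> bool" where
  "suffix_square m w \<longleftrightarrow> (\<exists>x v. w = x @ v @ v \<and> length v = m)"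

lemma suffix_square_iff:
  "suffix_square m w \<longleftrightarrow>
     2 * m \<le> length w \<and> (\<forall>k\<in>{1..m}. w ! (length w - k) = w ! (length w - m - k))"
proof
  assume "suffix_square m w"
  then obtain x v where w: "w = x @ v @ v" "length v = m" by (auto simp: suffix_square_def)
  have "w ! (length w - k) = w ! (length w - m - k)" if "k \<in> {1..m}" for k
  proof -
    define q where "q = m - k"
    have q: "m = q + k" "q < m" using that by (auto simp: q_def)
    have "length w - k = length x + (m + q)" "length w - m - k = length x + q"
      using w q by auto
    then show ?thesis using w q(2) by (simp add: nth_append)
  qed
  moreover have "2 * m \<le> length w" using w by simp
  ultimately show "2 * m \<le> length w \<and> (\<forall>k\<in>{1..m}. w ! (length w - k) = w ! (length w - m - k))"
    by blast
next
  assume a': "2 * m \<le> length w \<and> (\<forall>k\<in>{1..m}. w ! (length w - k) = w ! (length w - m - k))"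
  then have a: "2 * m \<le> length w" by blast
  let ?n = "length w"
  let ?u = "take m (drop (?n - 2 * m) w)" and ?v = "drop (?n - m) w"
  have "?u = ?v"
  proof (rule nth_equalityI)
    show "length ?u = length ?v" using a by simp
    fix q assume "q < length ?u"
    then have q: "q < m" by simp
    have e: "?n - (m - q) = ?n - m + q" "?n - m - (m - q) = ?n - 2 * m + q" using a q by auto
    have "w ! (?n - (m - q)) = w ! (?n - m - (m - q))"
      by (rule bspec[OF conjunct2[OF a']]) (use q in simp)
    then have "w ! (?n - m + q) = w ! (?n - 2 * m + q)" unfolding e .
    then show "?u ! q = ?v ! q" using a q by simp
  qed
  have "m + (?n - 2 * m) = ?n - m" using a by simp
  then have d: "drop m (drop (?n - 2 * m) w) = ?v" by (simp only: drop_drop)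
  have "?u @ drop m (drop (?n - 2 * m) w) = drop (?n - 2 * m) w" by (rule append_take_drop_id)
  then have e: "drop (?n - 2 * m) w = ?v @ ?v" unfolding d \<open>?u = ?v\<close> by (rule sym)
  have "length ?v = m" using a by simp
  then have "suffix_square m (take (?n - 2 * m) w @ drop (?n - 2 * m) w)"
    unfolding e suffix_square_def by blast
  then show "suffix_square m w" unfolding append_take_drop_id .
qed

lemma squarefree_len_iff_take:
  "squarefree_len m w \<longleftrightarrow> (\<forall>n\<le>length w. \<not> suffix_square m (take n w))"
proof
  assume s: "squarefree_len m w"
  show "\<forall>n\<le>length w. \<not> suffix_square m (take n w)"
  proof (intro allI impI notI)
    fix n assume "suffix_square m (take n w)"
    then obtain x v where "take n w = x @ v @ v" "length v = m" by (auto simp: suffix_square_def)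
    note xv = this
    have "w = take n w @ drop n w" by simp
    also have "\<dots> = x @ v @ v @ drop n w" unfolding xv(1) by simp
    finally show False using s xv(2) unfolding squarefree_len_def by blast
  qed
next
  assume a: "\<forall>n\<le>length w. \<not> suffix_square m (take n w)"
  show "squarefree_len m w"
    unfolding squarefree_len_def
  proof
    assume "\<exists>x v y. w = x @ v @ v @ y \<and> length v = m"
    then obtain x v y where w: "w = x @ v @ v @ y" "length v = m" by auto
    have "take (length (x @ v @ v)) w = x @ v @ v" unfolding w by simp
    moreover have "length (x @ v @ v) \<le> length w" unfolding w by simp
    ultimately have "\<not> suffix_square m (x @ v @ v)" using a by metis
    then show False using w(2) unfolding suffix_square_def by blast
  qed
qed

lemma strict_mono_enum:
  fixes J :: "nat set"
  assumes "finite J" "card J = l"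
  obtains j where "j ` {1..l} = J" "strict_mono_on {1..l} j"
proof -
  define L where "L = sorted_list_of_set J"
  have L: "set L = J" "length L = l" "sorted_wrt (<) L"
    using assms by (auto simp: L_def)
  have "(\<lambda>k. L ! (k - 1)) ` {1..l} = J"
  proof -
    have "(\<lambda>k. L ! (k - 1)) ` {1..l} = (!) L ` ((\<lambda>k. k - 1) ` {1..l})" by (simp add: image_image)
    also have "(\<lambda>k. k - 1) ` {1..l} = {..<l}" by (auto simp: image_iff intro!: bexI[of _ "Suc _"])
    also have "(!) L ` {..<l} = J" using L by (auto simp: set_conv_nth)
    finally show ?thesis .
  qed
  moreover have "strict_mono_on {1..l} (\<lambda>k. L ! (k - 1))"
    using L sorted_wrt_nth_less[OF L(3)] by (auto intro!: strict_mono_onI)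
  ultimately show ?thesis using that by blast
qed

lemma strict_mono_on_self:
  fixes j :: "nat \<Rightarrow> nat"
  assumes "strict_mono_on {1..l} j" "j ` {1..l} \<subseteq> {1..l}" "k \<in> {1..l}"
  shows "j k = k"
proof -
  have less: "j a < j b" if "a \<in> {1..l}" "b \<in> {1..l}" "a < b" for a b
    using assms(1) that by (auto simp: strict_mono_on_def)
  have "k \<le> l \<longrightarrow> k \<le> j k" if "1 \<le> k" for k
    using that
  proof (induction k rule: dec_induct)
    case base
    then show ?case using assms(2) by force
  next
    case (step n)
    then show ?case using less[of n "Suc n"] by auto
  qed
  moreover have "1 \<le> k \<longrightarrow> j k \<le> k" if "k \<le> l" for k
    using that
  proof (induction k rule: inc_induct)
    case base
    then show ?case using assms(2) by force
  next
    case (step n)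
    then show ?case using less[of n "Suc n"] by auto
  qed
  ultimately show ?thesis using assms(3) by (simp add: le_antisym)
qed

text \<open>Appending \<open>a\<close> completes a square of some length \<open>i (f a)\<close>,
  which forces \<open>p (i (f a)) = a\<close>. So \<open>f\<close> is injective, and the chosen
  lengths, one per letter, are a marked system in which every letter of \<open>A\<close>
  occurs.\<close>

lemma dead_end_subsequence:
  fixes A :: "'a set"
  assumes fin: "finite A" and card: "card A = l" and l: "l > 1" and seq: "increasing_seq r i"
    and dead: "dead_end A r i w"
  obtains j where "index_choice l r j"
    "\<not> doubling_seq l (\<lambda>k. i (j k))" "\<not> has_small_term l (\<lambda>k. i (j k))"
proof -
  define N where "N = 2 * i 1"
  define p where "p z = w ! (N - z)" for z
  have w: "set w \<subseteq> A" "length w = N" "\<And>t. t \<in> {1..r} \<Longrightarrow> squarefree_len (i t) w"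
    "\<And>a. a \<in> A \<Longrightarrow> \<exists>t\<in>{1..r}. suffix_square (i t) (tl w @ [a])"
    using dead by (auto simp: dead_end_def N_def squarefree_seq_def suffix_square_def)
  have pos: "1 \<le> i t" if "t \<in> {1..r}" for t using seq that by (auto simp: increasing_seq_def)
  have N0: "0 < N" using pos[of 1] seq unfolding N_def increasing_seq_def by force
  obtain f where f: "\<And>a. a \<in> A \<Longrightarrow> f a \<in> {1..r} \<and> suffix_square (i (f a)) (tl w @ [a])"
    using w(4) by metis
  \<comment> \<open>Dropping the first letter and appending \<open>a\<close> moves each position
    from the end up by one: \<open>a\<close> is now first, and \<open>p z\<close> sits at
    \<open>z + 1\<close>.\<close>
  have nth: "(tl w @ [a]) ! (N - 1) = a" "k \<in> {2..N} \<Longrightarrow> (tl w @ [a]) ! (N - k) = p (k - 1)" for a k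
    using w(2) N0 by (auto simp: nth_append nth_tl p_def Suc_diff_le numeral_2_eq_2)
  have sq: "2 * i (f a) \<le> N \<and> p (i (f a)) = a \<and> (\<forall>z. i (f a) < z \<and> z < 2 * i (f a) \<longrightarrow> p z = p (z - i (f a)))"
    if a: "a \<in> A" for a
  proof -
    let ?m = "i (f a)"
    have m1: "1 \<le> ?m" using f[OF a] pos by blast
    have len: "length (tl w @ [a]) = N" using w(2) N0 by simp
    have s: "2 * ?m \<le> N" "\<And>k. k \<in> {1..?m} \<Longrightarrow> (tl w @ [a]) ! (N - k) = (tl w @ [a]) ! (N - (?m + k))"
      using f[OF a] unfolding suffix_square_iff len by auto
    have "p ?m = a" using s(2)[of 1] nth(1)[of a] nth(2)[of "?m + 1" a] m1 s(1) by simp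
    moreover have "p z = p (z - ?m)" if z: "?m < z" "z < 2 * ?m" for z
    proof -
      obtain c where c: "z = ?m + c" using z(1) less_imp_add_positive by blast
      then show ?thesis
        using s(2)[of "c + 1"] nth(2)[of "c + 1" a] nth(2)[of "?m + (c + 1)" a] z s(1) by simp
    qed
    ultimately show ?thesis using s(1) by blast
  qed
  have sq_len: "2 * i (f a) \<le> N" and sq_letter: "p (i (f a)) = a" if "a \<in> A" for a
    using sq[OF that] by blast+
  have "inj_on f A" using sq_letter by (metis inj_onI)
  then have "card (f ` A) = l" using card card_image by blast
  then obtain j where j: "j ` {1..l} = f ` A" "strict_mono_on {1..l} j"
    using strict_mono_enum[of "f ` A" l] fin by blast
  have jf: "\<exists>a\<in>A. j t = f a" if "t \<in> {1..l}" for t using that j(1) by blast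
  have jr: "j t \<in> {1..r}" if "t \<in> {1..l}" for t using jf[OF that] f by force
  have less: "j s < j t" if "s \<in> {1..l}" "t \<in> {1..l}" "s < t" for s t
    using j(2) that by (auto simp: strict_mono_on_def)
  note dec = increasing_seq_less[OF seq]
  let ?k = "\<lambda>k. i (j k)"
  have seqk: "increasing_seq l ?k"
    unfolding increasing_seq_def
  proof (intro conjI ballI allI impI)
    show "1 \<le> ?k t" if "t \<in> {1..l}" for t using pos jr that by simp
    show "?k (t + 1) < ?k t" if "1 \<le> t \<and> t < l" for t
      using dec[of "j t" "j (t + 1)"] less[of t "t + 1"] jr[of t] jr[of "t + 1"] that by auto
  qed (use l in simp)
  have k1: "2 * ?k t \<le> 2 * ?k 1" "2 * ?k t \<le> N" if "t \<in> {1..l}" for t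
  proof -
    show "2 * ?k t \<le> N" using jf[OF that] sq_len by auto
    show "2 * ?k t \<le> 2 * ?k 1"
      using dec[of "j 1" "j t"] less[of 1 t] jr[of t] jr[of 1] that by (cases "t = 1") auto
  qed
  have letters: "(\<lambda>t. p (?k t)) ` {1..l} = A"
  proof -
    have "(\<lambda>t. p (?k t)) ` {1..l} = (\<lambda>a. p (i a)) ` f ` A" unfolding j(1)[symmetric] by (simp add: image_image)
    also have "\<dots> = A" using sq_letter by (force simp: image_image)
    finally show ?thesis .
  qed
  have sys: "\<not> doubling_seq l ?k" "\<not> has_small_term l ?k"
  proof -
    have per: "p z = p (z - ?k t)" if "t \<in> {1..l}" "?k t < z" "z < 2 * ?k t" for t z
      using jf[OF that(1)] sq that(2,3) by metis
    have inj: "inj_on (\<lambda>t. p (?k t)) {1..l}"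
      by (rule eq_card_imp_inj_on) (use letters card in auto)
    have last: "p (2 * ?k 1) \<in> (\<lambda>t. p (?k t)) ` {1..l}"
    proof -
      have "N - 2 * ?k 1 < length w" using w(2) N0 pos[OF jr[of 1]] l by simp
      then have "p (2 * ?k 1) \<in> set w" unfolding p_def by (rule nth_mem)
      then show ?thesis unfolding letters using w(1) by (rule subsetD[rotated])
    qed
    \<comment> \<open>Positions \<open>2 * ?k 1 - 2 * ?k s + 1\<close> to \<open>2 * ?k 1\<close>
      from the end are the last \<open>2 * ?k s\<close> letters of the prefix of length
      \<open>?n\<close>. Since \<open>?k 1\<close> may be smaller than \<open>i 1\<close>, this
      stretch need not begin at the start of \<open>w\<close>.\<close>
    have end_sq: "\<exists>c\<in>{1..?k s}. p (2 * ?k 1 - 2 * ?k s + c) \<noteq> p (2 * ?k 1 - ?k s + c)"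
      if s: "s \<in> {1..l}" for s
    proof -
      let ?n = "N - 2 * ?k 1 + 2 * ?k s"
      have n: "?n \<le> N" using k1[OF s] k1[of 1] l by simp
      have "\<not> suffix_square (?k s) (take ?n w)"
        using w(3)[OF jr[OF s]] n w(2) by (auto simp: squarefree_len_iff_take)
      then obtain c where c: "c \<in> {1..?k s}" "w ! (?n - c) \<noteq> w ! (?n - ?k s - c)"
        using n w(2) by (auto simp: suffix_square_iff)
      have "N - (2 * ?k 1 - 2 * ?k s + c) = ?n - c" "N - (2 * ?k 1 - ?k s + c) = ?n - ?k s - c"
        using c k1[OF s] k1[of 1] l by auto
      then show ?thesis using c unfolding p_def by metis
    qed
    show "\<not> doubling_seq l ?k" "\<not> has_small_term l ?k"
      by (rule marked_system_not_exceptional[of l ?k p, OF seqk per inj last end_sq]; assumption)+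
  qed
  show ?thesis
    by (rule that[of j]) (use j(2) jr sys in \<open>auto simp: index_choice_def\<close>)
qed

subsection \<open>Words tiled by prefixes\<close>

definition prefix_word :: "(nat \<Rightarrow> 'a) \<Rightarrow> nat \<Rightarrow> 'a list" where
  "prefix_word p n = map p [1..<Suc n]"

lemma length_prefix_word [simp]: "length (prefix_word p n) = n"
  by (simp add: prefix_word_def)

lemma nth_prefix_word [simp]: "k < n \<Longrightarrow> prefix_word p n ! k = p (Suc k)"
  by (simp add: prefix_word_def del: upt_Suc)

lemma prefix_word_cong:
  assumes "\<And>z. 0 < z \<Longrightarrow> z \<le> n \<Longrightarrow> p z = q z"
  shows "prefix_word p n = prefix_word q n"
  by (rule nth_equalityI) (use assms in auto)

lemma prefix_word_add:
  assumes "\<And>z. 0 < z \<Longrightarrow> z \<le> n \<Longrightarrow> p (x + z) = p z"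
  shows "prefix_word p (x + n) = prefix_word p x @ prefix_word p n"
proof (rule nth_equalityI)
  fix k assume "k < length (prefix_word p (x + n))"
  then have k: "k < x + n" by simp
  show "prefix_word p (x + n) ! k = (prefix_word p x @ prefix_word p n) ! k"
  proof (cases "k < x")
    case False
    then obtain w where w: "k = x + w" using le_Suc_ex by (metis not_le)
    have "p (x + Suc w) = p (Suc w)" by (rule assms) (use w k in auto)
    then show ?thesis using w k by (simp add: nth_append)
  qed (use k in \<open>simp add: nth_append\<close>)
qed simp

lemma suffix_square_append:
  assumes "2 * m \<le> length b" "suffix_square m (a @ b)"
  shows "suffix_square m b"
proof -
  have "b ! (length b - k) = b ! (length b - m - k)" if k: "k \<in> {1..m}" for k
  proof -
    have "(a @ b) ! (length (a @ b) - k) = (a @ b) ! (length (a @ b) - m - k)"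
      using assms(2) k unfolding suffix_square_iff by blast
    moreover have "length (a @ b) - k = length a + (length b - k)"
      "length (a @ b) - m - k = length a + (length b - m - k)"
      using assms(1) k by auto
    ultimately show ?thesis by (simp only: nth_append_length_plus)
  qed
  then show ?thesis using assms(1) unfolding suffix_square_iff by blast
qed

text \<open>The last letter of \<open>a\<close> lies in the first half of the square, and its
  partner, \<open>m\<close> places later, is the \<open>m\<close>-th letter of \<open>b\<close>.
  Applied to tiles, this compares the letter of a mark with \<open>p m\<close>.\<close>

lemma suffix_square_last:
  assumes "suffix_square m (a @ b)" "a \<noteq> []" "m \<le> length b" "length b < 2 * m"
  shows "last a = b ! (m - 1)"
proof -
  let ?k = "length b + 1 - m"
  have k: "?k \<in> {1..m}" using assms by auto
  have "(a @ b) ! (length (a @ b) - ?k) = (a @ b) ! (length (a @ b) - m - ?k)"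
    using assms(1) k unfolding suffix_square_iff by blast
  moreover have "length (a @ b) - ?k = length a + (m - 1)" "length (a @ b) - m - ?k = length a - 1"
    using assms by auto
  moreover have "(a @ b) ! (length a - 1) = last a"
    using assms(2) by (simp add: nth_append last_conv_nth)
  ultimately show ?thesis by (simp only: nth_append_length_plus)
qed

lemma suffix_square_prefix_word:
  assumes "suffix_square u (prefix_word p n)" "n - u < s" "s \<le> n"
  shows "2 * u \<le> n" "p s = p (s - u)"
proof -
  show le: "2 * u \<le> n" using assms(1) by (simp add: suffix_square_iff)
  have k: "n + 1 - s \<in> {1..u}" using assms by auto
  then have "prefix_word p n ! (n - (n + 1 - s)) = prefix_word p n ! (n - u - (n + 1 - s))"
    using assms(1) unfolding suffix_square_iff length_prefix_word by blast
  moreover have "n - (n + 1 - s) = s - 1" "n - u - (n + 1 - s) = s - u - 1" using assms le by auto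
  moreover have "u < s" using assms le by linarith
  moreover have "Suc (s - u - 1) = s - u" "Suc (s - 1) = s" "s - 1 < n" "s - u - 1 < n"
    using \<open>u < s\<close> assms(3) by auto
  ultimately show "p s = p (s - u)" by (simp only: nth_prefix_word)
qed

lemma suffix_square_two_prefix_words:
  assumes "suffix_square u (prefix_word p x @ prefix_word p j)" "x + j - u < s" "s \<le> x + j"
  shows "(if s \<le> x then p s else p (s - x)) = (if s - u \<le> x then p (s - u) else p (s - u - x))"
proof -
  let ?f = "\<lambda>s. if s \<le> x then p s else p (s - x)"
  have "prefix_word p x @ prefix_word p j = prefix_word ?f (x + j)"
  proof (rule nth_equalityI)
    fix k assume "k < length (prefix_word p x @ prefix_word p j)"
    then show "(prefix_word p x @ prefix_word p j) ! k = prefix_word ?f (x + j) ! k"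
      by (simp add: nth_append Suc_diff_le)
  qed simp
  then show ?thesis using suffix_square_prefix_word(2)[of u ?f "x + j" s] assms by simp
qed

definition tiles_squarefree :: "(nat \<Rightarrow> 'a) \<Rightarrow> nat set \<Rightarrow> nat \<Rightarrow> bool" where
  "tiles_squarefree p X u \<longleftrightarrow>
     (\<forall>xs j. set xs \<subseteq> X \<longrightarrow> \<not> suffix_square u (concat (map (prefix_word p) xs) @ prefix_word p j))"

text \<open>Past its largest mark \<open>x < z\<close> the prefix of length \<open>z\<close> starts
  over, so a tile of length \<open>x\<close> splits off and the rest is a shorter prefix.\<close>

lemma prefix_word_tiling:
  assumes cop: "\<And>z. z \<notin> X \<Longrightarrow> copies X p z" and y: "y \<in> X" "\<And>x. x \<in> X \<Longrightarrow> y \<le> x" "0 < y"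
  shows "\<exists>xs j. set xs \<subseteq> X \<and> j < y \<and> prefix_word p z = concat (map (prefix_word p) xs) @ prefix_word p j"
proof (induction z rule: less_induct)
  case (less z)
  consider "z < y" | "z \<in> X" | "y < z" "z \<notin> X" using y(1) by (metis nat_neq_iff)
  then show ?case
  proof cases
    case 1
    then show ?thesis by (intro exI[of _ "[]"] exI[of _ z]) simp
  next
    case 2
    then show ?thesis using y(3) by (intro exI[of _ "[z]"] exI[of _ 0]) (simp add: prefix_word_def)
  next
    case 3
    obtain x where x: "x \<in> X" "x < z" and mx: "\<And>x'. x' \<in> X \<Longrightarrow> x' < z \<Longrightarrow> x' \<le> x"
      using max_below[OF y(1) 3(1)] by metis
    have "p (x + w) = p w" if w: "0 < w" "w \<le> z - x" for w
    proof -
      have below: "x' \<le> x" if "x' \<in> X" "x' \<le> x + w" for x'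
      proof -
        have "x' \<le> z" using that(2) w x by linarith
        then have "x' < z" using that(1) 3(2) by (metis nat_less_le)
        then show ?thesis using mx that(1) by blast
      qed
      have "x + w \<notin> X" using below[of "x + w"] w by auto
      have "p (x + w) = p (x + w - x)"
        by (rule copiesD[OF cop[OF \<open>x + w \<notin> X\<close>] x(1)]) (use w below in auto)
      then show ?thesis by simp
    qed
    then have "prefix_word p (x + (z - x)) = prefix_word p x @ prefix_word p (z - x)"
      by (rule prefix_word_add)
    then have "prefix_word p z = prefix_word p x @ prefix_word p (z - x)" using x by simp
    moreover obtain xs j where "set xs \<subseteq> X" "j < y"
      "prefix_word p (z - x) = concat (map (prefix_word p) xs) @ prefix_word p j"
      using less[of "z - x"] x y by fastforce
    ultimately show ?thesis using x(1) by (intro exI[of _ "x # xs"] exI[of _ j]) simp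
  qed
qed

text \<open>A suffix square that lies neither inside the last prefix nor inside the last tile
  followed by that prefix reaches back over the end of a tile so that a mark is compared with
  \<open>p u\<close>, which has another letter. A last prefix with \<open>j \<ge> y\<close> is tiled
  again first.\<close>

lemma tiles_squarefreeI:
  assumes cop: "\<And>z. z \<notin> X \<Longrightarrow> copies X p z" and y: "y \<in> X" "\<And>x. x \<in> X \<Longrightarrow> y \<le> x"
    and u: "0 < u" "u < y" "\<And>x. x \<in> X \<Longrightarrow> p x \<noteq> p u"
    and one: "\<And>j. j < y \<Longrightarrow> \<not> suffix_square u (prefix_word p j)"
    and two: "\<And>x j. x \<in> X \<Longrightarrow> j < u \<Longrightarrow> 2 * u \<le> x + j \<Longrightarrow>
      \<not> suffix_square u (prefix_word p x @ prefix_word p j)"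
  shows "tiles_squarefree p X u"
proof -
  have y0: "0 < y" using u by simp
  have main: "\<not> suffix_square u (concat (map (prefix_word p) xs) @ prefix_word p j)"
    if xs: "set xs \<subseteq> X" and j: "j < y" for xs j
  proof
    assume sq: "suffix_square u (concat (map (prefix_word p) xs) @ prefix_word p j)"
    show False
    proof (cases xs rule: rev_cases)
      case Nil
      then show False using sq one[OF j] by simp
    next
      case (snoc ys x)
      let ?A = "concat (map (prefix_word p) ys)"
      have x: "x \<in> X" using xs snoc by simp
      have xu: "u < x" using y(2)[OF x] u(2) by simp
      have lastx: "prefix_word p x \<noteq> []" "last (prefix_word p x) = p x" if "x \<in> X" for x
      proof -
        have "0 < x" using y(2)[OF that] y0 by simp
        then show "prefix_word p x \<noteq> []" by (simp flip: length_greater_0_conv)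
        then show "last (prefix_word p x) = p x" using \<open>0 < x\<close> by (simp add: last_conv_nth)
      qed
      have sq': "suffix_square u (?A @ prefix_word p x @ prefix_word p j)" using sq snoc by simp
      consider "2 * u \<le> j" | "u \<le> j" "j < 2 * u" | "j < u" by linarith
      then show False
      proof cases
        case 1
        then have "suffix_square u (prefix_word p j)"
          using suffix_square_append[of u "prefix_word p j" "?A @ prefix_word p x"] sq' by simp
        then show False using one[OF j] by simp
      next
        case 2
        have "last (?A @ prefix_word p x) = prefix_word p j ! (u - 1)"
          by (rule suffix_square_last) (use sq' 2 lastx[OF x] in auto)
        then show False using lastx[OF x] u 2 x by simp
      next
        case 3
        show False
        proof (cases "2 * u \<le> x + j")
          case True
          then have "suffix_square u (prefix_word p x @ prefix_word p j)"
            using suffix_square_append[of u "prefix_word p x @ prefix_word p j" ?A] sq' by simp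
          then show False using two[OF x 3 True] by simp
        next
          case False
          have "2 * u \<le> length ?A + (x + j)" using sq' by (simp add: suffix_square_iff)
          then have "ys \<noteq> []" using False by auto
          then obtain zs x' where ys: "ys = zs @ [x']" by (metis rev_exhaust)
          then have x': "x' \<in> X" using xs snoc by simp
          have A: "?A \<noteq> []" "last ?A = p x'" using ys lastx[OF x'] by auto
          have "last ?A = (prefix_word p x @ prefix_word p j) ! (u - 1)"
            by (rule suffix_square_last) (use sq' A False xu in auto)
          also have "\<dots> = p u" using xu u by (simp add: nth_append)
          finally show False using A u(3)[OF x'] by simp
        qed
      qed
    qed
  qed
  show ?thesis
    unfolding tiles_squarefree_def
  proof (intro allI impI)
    fix xs j assume xs: "set xs \<subseteq> X"
    obtain ys j' where ys: "set ys \<subseteq> X" "j' < y"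
      "prefix_word p j = concat (map (prefix_word p) ys) @ prefix_word p j'"
      using prefix_word_tiling[OF cop y y0] by blast
    then show "\<not> suffix_square u (concat (map (prefix_word p) xs) @ prefix_word p j)"
      using main[of "xs @ ys" j'] xs by simp
  qed
qed

subsection \<open>Building the word one length at a time\<close>

text \<open>The bound \<open>2 \<le> t\<close> is built in because several mismatches are taken one
  position before the end of a square, which must still lie in its second half.\<close>

fun superdecreasing :: "nat list \<Rightarrow> bool" where
  "superdecreasing [] \<longleftrightarrow> True"
| "superdecreasing (t # T) \<longleftrightarrow> 2 \<le> t \<and> sum_list T < t \<and> superdecreasing T"

text \<open>A single entry counts as doubling, so that no first letter is demanded when no length is
  left and \<open>final_letter\<close> would have no letter to offer.\<close>

fun doubling_list :: "nat list \<Rightarrow> bool" where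
  "doubling_list (s # t # T) \<longleftrightarrow> s = 2 * t \<and> doubling_list (t # T)"
| "doubling_list T \<longleftrightarrow> True"

text \<open>\<open>c\<close> gives the letters at the marks, \<open>d\<close> those at the remaining
  lengths. The bound by the whole sum, not just by the largest length, is what a cut preserves:
  \<open>m + sum_list T < x\<close> yields \<open>sum_list T < x - m\<close>.\<close>

definition marking :: "nat set \<Rightarrow> nat list \<Rightarrow> (nat \<Rightarrow> 'a) \<Rightarrow> (nat \<Rightarrow> 'a) \<Rightarrow> bool" where
  "marking X T c d \<longleftrightarrow> finite X \<and> X \<noteq> {} \<and> superdecreasing T \<and> (\<forall>x\<in>X. sum_list T < x) \<and>
     inj_on c X \<and> inj_on d (set T) \<and> c ` X \<inter> d ` set T = {}"

text \<open>The clause on \<open>p (x' - x)\<close> prepares the undoing of the cut at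
  \<open>m\<close>: with \<open>x' = m\<close> it excludes squares of length \<open>m\<close> that
  straddle a mark below \<open>2 * m\<close>.\<close>

definition coding :: "nat set \<Rightarrow> nat list \<Rightarrow> (nat \<Rightarrow> 'a) \<Rightarrow> (nat \<Rightarrow> 'a) \<Rightarrow> (nat \<Rightarrow> 'a) \<Rightarrow> bool" where
  "coding X T c d p \<longleftrightarrow>
     (\<forall>x\<in>X. p x = c x) \<and> (\<forall>t\<in>set T. p t = d t) \<and>
     (\<forall>z. z \<notin> X \<longrightarrow> copies X p z) \<and>
     (\<forall>t\<in>set T. \<forall>z. t < z \<longrightarrow> z < 2 * t \<longrightarrow> p z = p (z - t)) \<and>
     (\<forall>z>0. p z \<in> c ` X \<union> d ` set T) \<and>
     (\<forall>x\<in>X. \<forall>x'\<in>X. x < x' \<longrightarrow> p (x' - x) \<noteq> c x') \<and>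
     (\<forall>t\<in>set T. tiles_squarefree p X t)"

text \<open>
  A letter \<open>b\<close> at position \<open>2 y\<close> completes no square of a length in \<open>T\<close>: either the letters at \<open>2 y\<close>
  and \<open>2 y - u\<close> differ, or those one position earlier do (both seen through the period \<open>y\<close>).
\<close>

definition final_letter :: "nat \<Rightarrow> nat list \<Rightarrow> (nat \<Rightarrow> 'a) \<Rightarrow> (nat \<Rightarrow> 'a) \<Rightarrow> 'a \<Rightarrow> bool" where
  "final_letter y T d p b \<longleftrightarrow> b \<in> d ` set T \<and>
     (\<forall>u\<in>set T. b \<noteq> p (y - u) \<or> u + 1 < y \<and> p (y - 1) \<noteq> p (y - 1 - u))"

lemma superdecreasing_mem:
  assumes "superdecreasing T" "t \<in> set T"
  shows "2 \<le> t" "t \<le> sum_list T"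
  using assms by (induction T) (auto simp: trans_le_add2)

definition step_marks :: "nat set \<Rightarrow> nat \<Rightarrow> nat set" where
  "step_marks X m = insert m {x - m | x. x \<in> X \<and> x < 2 * m}"

definition step_letters :: "nat \<Rightarrow> (nat \<Rightarrow> 'a) \<Rightarrow> (nat \<Rightarrow> 'a) \<Rightarrow> nat \<Rightarrow> 'a" where
  "step_letters m c d z = (if z = m then d m else c (z + m))"

lemma marking_step:
  assumes "marking X (m # T) c d"
  shows "marking (step_marks X m) T (step_letters m c d) d"
proof -
  note a = assms[unfolded marking_def]
  have gt: "m + sum_list T < x" if "x \<in> X" for x using a that by simp
  have fin: "finite (step_marks X m)" using a by (simp add: step_marks_def)
  have ab: "\<forall>x\<in>step_marks X m. sum_list T < x"
  proof
    fix x' assume "x' \<in> step_marks X m"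
    then consider "x' = m" | x where "x \<in> X" "x' = x - m" by (auto simp: step_marks_def)
    then show "sum_list T < x'"
    proof cases
      case (2 x)
      then show ?thesis using gt[of x] by simp
    qed (use a in simp)
  qed
  have val: "x' = m \<and> step_letters m c d x' = d m \<or>
      (\<exists>x\<in>X. x' \<noteq> m \<and> x = x' + m \<and> step_letters m c d x' = c x)" if "x' \<in> step_marks X m" for x'
  proof (cases "x' = m")
    case False
    then obtain x where x: "x \<in> X" "x' = x - m" using \<open>x' \<in> step_marks X m\<close> by (auto simp: step_marks_def)
    then have "x = x' + m" using gt[of x] by simp
    then show ?thesis using x(1) False by (auto simp: step_letters_def)
  qed (simp add: step_letters_def)
  have dT: "d m \<notin> d ` set T"
  proof
    assume "d m \<in> d ` set T"
    then obtain t where t: "t \<in> set T" "d m = d t" by auto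
    then have "m = t" using inj_onD[of d "set (m # T)" m t] a by simp
    moreover have "t \<le> sum_list T" using superdecreasing_mem(2)[OF _ t(1)] a by simp
    ultimately show False using a by simp
  qed
  have "inj_on (step_letters m c d) (step_marks X m)"
  proof (rule inj_onI)
    fix x y assume xy: "x \<in> step_marks X m" "y \<in> step_marks X m" "step_letters m c d x = step_letters m c d y"
    have ic: "inj_on c X" using a by simp
    have dc: "d m \<notin> c ` X" using a by auto
    from val[OF xy(1)] val[OF xy(2)] show "x = y"
      using xy(3) dc inj_onD[OF ic] by (metis add_right_cancel image_eqI)
  qed
  moreover have "step_letters m c d ` step_marks X m \<inter> d ` set T = {}"
  proof -
    have dc: "c x \<notin> d ` set T" if "x \<in> X" for x using a that by auto
    have "step_letters m c d x' \<notin> d ` set T" if "x' \<in> step_marks X m" for x'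
      using val[OF that] dc dT by metis
    then show ?thesis by auto
  qed
  moreover have "step_marks X m \<noteq> {}" by (simp add: step_marks_def)
  moreover have "inj_on d (set T)" using a by (simp add: inj_on_def)
  ultimately show ?thesis using fin ab a unfolding marking_def by simp
qed

text \<open>
  \<open>p_mismatch\<close> keeps the free stretch free of squares; it is waived at \<open>z = y - u\<close>, where \<open>p_exempt\<close>
  needs the room. At \<open>z = 2 m\<close> nothing can be waived since \<open>z - 1\<close> is a copy of \<open>z - 1 - m\<close>; there
  \<open>p_exempt\<close> is given up instead.
\<close>

locale extension_step =
  fixes X :: "nat set" and m :: nat and T :: "nat list" and c d :: "nat \<Rightarrow> 'a"
    and q p :: "nat \<Rightarrow> 'a" and y :: nat
  assumes marking: "marking X (m # T) c d"
    and coding: "coding (step_marks X m) T (step_letters m c d) d q"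
    and y: "y \<in> X" "\<And>x. x \<in> X \<Longrightarrow> y \<le> x"
    and p_mark: "\<And>x. x \<in> X \<Longrightarrow> p x = c x"
    and p_copies: "\<And>z. z \<notin> X \<Longrightarrow> copies X p z"
    and p_low: "\<And>z. z < 2 * m \<Longrightarrow> z < y \<Longrightarrow> p z = q z"
    and p_free: "\<And>z. 2 * m \<le> z \<Longrightarrow> z < y \<Longrightarrow> p z \<in> insert (c y) (d ` set (m # T))"
    and p_mismatch: "\<And>z u. 2 * m \<le> z \<Longrightarrow> z < y \<Longrightarrow> u \<in> set (m # T) \<Longrightarrow> z = 2 * m \<or> z + u \<noteq> y \<Longrightarrow> p z \<noteq> p (z - u)"
    and p_exempt: "\<And>z u. 2 * m < z \<Longrightarrow> z < y \<Longrightarrow> u \<in> set (m # T) \<Longrightarrow> z + u = y \<Longrightarrow> p z \<noteq> c y"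
begin

abbreviation "Y \<equiv> step_marks X m"
abbreviation "c' \<equiv> step_letters m c d"

lemma sd: "superdecreasing (m # T)" and inj_c: "inj_on c X" and inj_d: "inj_on d (set (m # T))"
  using marking by (simp_all add: marking_def)

lemma disj: "x \<in> X \<Longrightarrow> t \<in> set (m # T) \<Longrightarrow> c x \<noteq> d t"
  using marking unfolding marking_def by blast

lemma sum_less: "x \<in> X \<Longrightarrow> m + sum_list T < x"
  using marking by (simp add: marking_def)

lemma tail_less: "u \<in> set T \<Longrightarrow> 2 \<le> u \<and> u < m"
  using superdecreasing_mem[of T u] sd by auto

lemma tail_ge2: "u \<in> set (m # T) \<Longrightarrow> 2 \<le> u \<and> u \<le> m"
  using tail_less[of u] sd by auto

lemma mark_gt: "x \<in> X \<Longrightarrow> m < x"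
  using sum_less by fastforce

lemmas q_mark = coding[unfolded coding_def, THEN conjunct1, rule_format]
lemmas q_tail = coding[unfolded coding_def, THEN conjunct2, THEN conjunct1, rule_format]
lemmas q_copies = coding[unfolded coding_def, THEN conjunct2, THEN conjunct2, THEN conjunct1, rule_format]
lemmas q_per = coding[unfolded coding_def, THEN conjunct2, THEN conjunct2, THEN conjunct2, THEN conjunct1, rule_format]
lemmas q_range = coding[unfolded coding_def, THEN conjunct2, THEN conjunct2, THEN conjunct2, THEN conjunct2, THEN conjunct1, rule_format]
lemmas q_diff = coding[unfolded coding_def, THEN conjunct2, THEN conjunct2, THEN conjunct2, THEN conjunct2, THEN conjunct2, THEN conjunct1, rule_format]
lemmas q_tiles = coding[unfolded coding_def, THEN conjunct2, THEN conjunct2, THEN conjunct2, THEN conjunct2, THEN conjunct2, THEN conjunct2, rule_format]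

lemma Y_le: "x' \<in> Y \<Longrightarrow> x' \<le> m"
  by (auto simp: step_marks_def)

lemma m_in_Y: "m \<in> Y"
  by (simp add: step_marks_def)

lemma Y_iff: "0 < z \<Longrightarrow> z < m \<Longrightarrow> z \<in> Y \<longleftrightarrow> z + m \<in> X"
  using mark_gt by (force simp: step_marks_def)

lemma c'_low: "x \<in> X \<Longrightarrow> x < 2 * m \<Longrightarrow> x - m \<in> Y \<and> c' (x - m) = c x"
  using mark_gt[of x] by (auto simp: step_marks_def step_letters_def)

lemma c'_m: "c' m = d m"
  by (simp add: step_letters_def)

lemma q_shift:
  assumes "m < z"
  shows "q z = q (z - m)"
proof -
  have "z \<notin> Y" using Y_le assms by fastforce
  then show ?thesis by (rule copiesD[OF q_copies m_in_Y assms Y_le])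
qed

text \<open>\<open>q\<close> restarts at \<open>m\<close>, so its restart at \<open>x - m\<close> is
  seen again, beyond \<open>m\<close>, as a restart at \<open>x\<close>.\<close>

lemma q_copies_X:
  assumes z: "z < 2 * m" "z \<notin> X"
  shows "copies X q z"
proof (rule copiesI)
  fix x assume x: "x \<in> X" "x < z" and mx: "\<And>x'. x' \<in> X \<Longrightarrow> x' < z \<Longrightarrow> x' \<le> x"
  have mz: "m < x" using mark_gt x by simp
  have "z - m \<notin> Y" using Y_iff[of "z - m"] z mz x by simp
  then have "q (z - m) = q (z - m - (x - m))"
  proof (rule copiesD[OF q_copies])
    show "x - m \<in> Y" using c'_low x z by simp
    show "x - m < z - m" using x mz by simp
    fix e assume e: "e \<in> Y" "e < z - m"
    show "e \<le> x - m"
    proof (cases "e = 0")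
      case False
      then have "e + m \<in> X" using Y_iff[of e] e z by simp
      moreover have "e + m < z" using e(2) by linarith
      ultimately have "e + m \<le> x" by (rule mx)
      then show ?thesis by linarith
    qed simp
  qed
  then show "q z = q (z - x)" using q_shift[of z] mz x by simp
qed

lemma p_copy:
  assumes "z \<notin> X" "y < z"
  obtains x where "x \<in> X" "x < z" "p z = p (z - x)" "\<And>x'. x' \<in> X \<Longrightarrow> x' < z \<Longrightarrow> x' \<le> x"
  using max_below[OF y(1) assms(2)] copiesD[OF p_copies[OF assms(1)]] by metis

text \<open>At a mark \<open>x < 2 * m\<close> both words have \<open>c x\<close>, because
  \<open>q\<close> restarts at \<open>m\<close> and \<open>x - m\<close> has inherited the letter of
  \<open>x\<close>; at other positions above \<open>y\<close> both copy from the same mark.\<close>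

lemma p_eq_q: "z < 2 * m \<Longrightarrow> p z = q z"
proof (induction z rule: less_induct)
  case (less z)
  consider "z < y" | "z \<in> X" | "y < z" "z \<notin> X" using y(1) by (metis nat_neq_iff)
  then show ?case
  proof cases
    case 1
    then show ?thesis using p_low less.prems by simp
  next
    case 2
    then show ?thesis
      using p_mark q_shift[OF mark_gt] q_mark[of "z - m"] c'_low[of z] less.prems by simp
  next
    case 3
    obtain x where x: "x \<in> X" "x < z" "p z = p (z - x)" and mx: "\<And>x'. x' \<in> X \<Longrightarrow> x' < z \<Longrightarrow> x' \<le> x"
      using p_copy[OF 3(2,1)] by metis
    have "q z = q (z - x)" using copiesD[OF q_copies_X[OF less.prems 3(2)] x(1,2) mx] by simp
    then show ?thesis using x less.IH[of "z - x"] less.prems mark_gt[OF x(1)] by simp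
  qed
qed

lemma p_tail: "t \<in> set (m # T) \<Longrightarrow> p t = d t"
  using p_eq_q[of t] q_mark[OF m_in_Y] c'_m q_tail[of t] tail_ge2[of t] by auto

lemma p_per:
  assumes "t \<in> set (m # T)" "t < z" "z < 2 * t"
  shows "p z = p (z - t)"
proof -
  have z: "z < 2 * m" using assms tail_ge2 by fastforce
  show ?thesis
  proof (cases "t = m")
    case True
    then show ?thesis using q_shift[of z] assms p_eq_q[OF z] p_eq_q[of "z - t"] z by simp
  next
    case False
    then show ?thesis using q_per[of t z] assms p_eq_q[OF z] p_eq_q[of "z - t"] z by simp
  qed
qed

lemma q_letters:
  assumes "0 < z"
  shows "q z \<in> d ` set (m # T) \<or> (\<exists>x\<in>X. x < 2 * m \<and> q z = c x)"
proof -
  from q_range[OF assms] consider "q z \<in> d ` set T" | x' where "x' \<in> Y" "q z = c' x'" by blast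
  then show ?thesis
  proof cases
    case 1
    then show ?thesis by auto
  next
    case (2 x')
    show ?thesis
    proof (cases "x' = m")
      case True
      then show ?thesis using 2 c'_m by simp
    next
      case False
      then obtain x where "x \<in> X" "x < 2 * m" "x' = x - m" using 2(1) by (auto simp: step_marks_def)
      then have "x \<in> X \<and> x < 2 * m \<and> q z = c x" using c'_low 2(2) by simp
      then show ?thesis by blast
    qed
  qed
qed

lemma p_range: "0 < z \<Longrightarrow> p z \<in> c ` X \<union> d ` set (m # T)"
proof (induction z rule: less_induct)
  case (less z)
  consider "z < 2 * m" | "z \<in> X" | "2 * m \<le> z" "z < y" | "y < z" "z \<notin> X" using y(1) by (metis nat_neq_iff not_le)
  then show ?case
  proof cases
    case 1
    then show ?thesis using q_letters[OF less.prems] p_eq_q by auto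
  next
    case 2
    then show ?thesis using p_mark by simp
  next
    case 3
    then show ?thesis using p_free[of z] y(1) by auto
  next
    case 4
    obtain x where x: "x \<in> X" "x < z" "p z = p (z - x)" using p_copy[OF 4(2,1)] by metis
    then have "0 < z - x" "z - x < z" using mark_gt[OF x(1)] by auto
    then show ?thesis using less.IH[of "z - x"] x(3) by simp
  qed
qed

lemma p_low_neq:
  assumes "x \<in> X" "2 * m \<le> x" "0 < z" "z < 2 * m"
  shows "p z \<noteq> c x"
proof
  assume "p z = c x"
  then have qz: "q z = c x" using p_eq_q[OF assms(4)] by simp
  from q_letters[OF assms(3)] show False
  proof
    assume "q z \<in> d ` set (m # T)"
    then show False using qz disj[OF assms(1)] by (metis imageE)
  next
    assume "\<exists>x'\<in>X. x' < 2 * m \<and> q z = c x'"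
    then show False using qz assms(1,2) inj_onD[OF inj_c] by (metis not_le)
  qed
qed

text \<open>The letter of such a mark has no way to enter earlier: \<open>q\<close> uses only
  letters of lengths and of marks below \<open>2 * m\<close>, the free stretch adds only that of
  \<open>y\<close>, and the rest is copied.\<close>

lemma p_before_neq:
  assumes x: "x \<in> X" "2 * m \<le> x" "x \<noteq> y"
  shows "0 < z \<Longrightarrow> z < x \<Longrightarrow> p z \<noteq> c x"
proof (induction z rule: less_induct)
  case (less z)
  consider "z < 2 * m" | "z \<in> X" | "2 * m \<le> z" "z < y" | "y < z" "z \<notin> X" using y(1) by (metis nat_neq_iff not_le)
  then show ?case
  proof cases
    case 1
    then show ?thesis using p_low_neq x less.prems by simp
  next
    case 2
    then show ?thesis using p_mark[OF 2] inj_onD[OF inj_c, of z x] x(1) less.prems by auto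
  next
    case 3
    then have "p z = c y \<or> p z \<in> d ` set (m # T)" using p_free by blast
    moreover have "c y \<noteq> c x" using inj_onD[OF inj_c, of y x] x y(1) by blast
    moreover have "c x \<notin> d ` set (m # T)" using disj[OF x(1)] by blast
    ultimately show ?thesis by metis
  next
    case 4
    obtain x' where x': "x' \<in> X" "x' < z" "p z = p (z - x')" using p_copy[OF 4(2,1)] by metis
    then have "0 < z - x'" "z - x' < z" using mark_gt[OF x'(1)] by auto
    then show ?thesis using less.IH[of "z - x'"] x'(3) less.prems by simp
  qed
qed

lemma p_diff:
  assumes x: "x \<in> X" "x' \<in> X" "x < x'"
  shows "p (x' - x) \<noteq> c x'"
proof (cases "x' < 2 * m")
  case True
  have "m < x" using mark_gt x by simp
  then have "q ((x' - m) - (x - m)) \<noteq> c' (x' - m)"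
    by (intro q_diff) (use c'_low x True in auto)
  moreover have "(x' - m) - (x - m) = x' - x" using \<open>m < x\<close> by simp
  ultimately show ?thesis using c'_low[OF x(2) True] p_eq_q[of "x' - x"] True by simp
next
  case False
  then show ?thesis using p_before_neq[of x' "x' - x"] x y(2)[OF x(1)] mark_gt[OF x(1)] by simp
qed

lemma low_mark_tiling:
  assumes "x \<in> X" "x < 2 * m"
  shows "prefix_word p x = prefix_word q m @ prefix_word q (x - m)"
proof -
  have "prefix_word p x = prefix_word q x" by (rule prefix_word_cong) (use p_eq_q assms in auto)
  also have "\<dots> = prefix_word q (m + (x - m))" using mark_gt[OF assms(1)] by simp
  also have "\<dots> = prefix_word q m @ prefix_word q (x - m)"
    by (rule prefix_word_add) (use q_shift in simp)
  finally show ?thesis .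
qed

lemma low_prefix_word: "j < 2 * m \<Longrightarrow> prefix_word p j = prefix_word q j"
  by (rule prefix_word_cong) (use p_eq_q in auto)

text \<open>Below \<open>2 * m\<close> there is no room for length \<open>m\<close>, and
  \<open>q\<close> excludes the others. A square ending at a free \<open>j\<close> fails at
  \<open>j\<close>, or at \<open>j - 1\<close> if the mismatch at \<open>j\<close> is waived: then
  \<open>j > 2 * m\<close>, so \<open>j - 1\<close> is free too, it is not waived for the same
  \<open>u\<close>, and it lies in the second half since \<open>u \<ge> 2\<close>.\<close>

lemma prefix_squarefree:
  assumes u: "u \<in> set (m # T)" and j: "j < y"
  shows "\<not> suffix_square u (prefix_word p j)"
proof
  assume sq: "suffix_square u (prefix_word p j)"
  note mm = suffix_square_prefix_word[OF sq]
  have u2: "2 \<le> u" "u \<le> m" using tail_ge2[OF u] by auto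
  show False
  proof (cases "j < 2 * m")
    case True
    have "2 * u \<le> j" using sq by (simp add: suffix_square_iff)
    then have "u \<in> set T" using True u by auto
    then have "\<not> suffix_square u (concat (map (prefix_word q) []) @ prefix_word q j)"
      using q_tiles unfolding tiles_squarefree_def by (metis empty_iff empty_set subsetI)
    then show False using sq low_prefix_word[OF True] by simp
  next
    case False
    show False
    proof (cases "j = 2 * m \<or> j + u \<noteq> y")
      case True
      then show False using p_mismatch[of j u] False j u mm(2)[of j] u2 by simp
    next
      case False': False
      then have "2 * m \<le> j - 1" "j - 1 < y" "j - 1 + u \<noteq> y" using False j u2 by auto
      moreover have "j - u < j - 1" "j - 1 \<le> j" using u2 False by auto
      then have "p (j - 1) = p (j - 1 - u)" by (rule mm(2))
      ultimately show False using p_mismatch u by blast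
    qed
  qed
qed

lemma mark_squarefree:
  assumes u: "u \<in> set (m # T)" and x: "x \<in> X" and j: "j < u" "2 * u \<le> x + j"
  shows "\<not> suffix_square u (prefix_word p x @ prefix_word p j)"
proof
  assume sq: "suffix_square u (prefix_word p x @ prefix_word p j)"
  note mm = suffix_square_two_prefix_words[OF sq]
  have u2: "2 \<le> u" "u \<le> m" using tail_ge2[OF u] by auto
  have mx: "m < x" using mark_gt[OF x] .
  have at_mark: "p x = p (x - u)" using mm[of x] j by simp
  consider "x < 2 * m" "u \<in> set T" | "x < 2 * m" "u = m" | "2 * m \<le> x" "x \<noteq> y" | "2 * m \<le> x" "x = y"
    using u by fastforce
  then show False
  proof cases
    case 1
    have "set [m, x - m] \<subseteq> Y" using m_in_Y c'_low[OF x 1(1)] by simp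
    then have "\<not> suffix_square u (concat (map (prefix_word q) [m, x - m]) @ prefix_word q j)"
      using q_tiles[OF 1(2)] unfolding tiles_squarefree_def by blast
    then show False using sq low_mark_tiling[OF x 1(1)] low_prefix_word[of j] j u2 by simp
  next
    case 2
    \<comment> \<open>Position \<open>2 * m\<close> falls into the second prefix, and its partner is
      position \<open>m\<close>. Now \<open>2 * m - x = m - (x - m)\<close> is a difference of two
      marks of \<open>q\<close>.\<close>
    have "p (2 * m - x) = p m" using mm[of "2 * m"] 2 j mx by simp
    moreover have "p (2 * m - x) = q (m - (x - m))"
    proof -
      have e: "2 * m - x = m - (x - m)" using mx by simp
      have "p (2 * m - x) = q (2 * m - x)" by (rule p_eq_q) (use mx 2 in simp)
      also have "\<dots> = q (m - (x - m))" by (rule arg_cong[OF e])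
      finally show ?thesis .
    qed
    moreover have "q (m - (x - m)) \<noteq> c' m"
      by (rule q_diff) (use c'_low[OF x 2(1)] m_in_Y 2 in auto)
    ultimately show False using p_tail[of m] c'_m by simp
  next
    case 3
    then show False using p_before_neq[OF x, of "x - u"] at_mark p_mark[OF x] mx u2 by simp
  next
    case 4
    have cy: "p (y - u) = c y" using at_mark p_mark[OF x] 4 by simp
    consider "y - u < 2 * m" | "2 * m < y - u" | "y = 2 * m + u" "0 < j" | "y = 2 * m + u" "j = 0"
      using 4 u2 by linarith
    then show False
    proof cases
      case 1
      then show False using p_low_neq[of y "y - u"] cy x 4 mx u2 by simp
    next
      case 2
      then show False using p_exempt[of "y - u" u] cy u u2 by simp
    next
      case 3
      \<comment> \<open>The letter at \<open>y - u = 2 * m\<close> may be \<open>c y\<close>, so the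
        comparison one position later is used. Its mismatch for the length \<open>m\<close> is not
        waived, because \<open>2 * m + 1 + m \<noteq> y\<close> by \<open>u \<le> m\<close>.\<close>
      have "p 1 = p (2 * m + 1)" using mm[of "y + 1"] 3 4 j u2 by simp
      moreover have "p (2 * m + 1) \<noteq> p (2 * m + 1 - m)"
        by (rule p_mismatch) (use 3 u2 in auto)
      moreover have "p (m + 1) = p 1" using p_per[of m "m + 1"] u2 by simp
      ultimately show False by simp
    next
      case yu: 4
      \<comment> \<open>Nothing follows \<open>y\<close> here, so the comparison one position
        earlier is used; it is in the second half by \<open>u \<ge> 2\<close>.\<close>
      have "p (y - 1) = p (y - 1 - u)" using mm[of "y - 1"] 4 yu j u2 by simp
      moreover have "p (y - 1) \<noteq> p (y - 1 - u)"
        by (rule p_mismatch) (use yu u u2 in auto)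
      ultimately show False by simp
    qed
  qed
qed

lemma p_tiles:
  assumes u: "u \<in> set (m # T)"
  shows "tiles_squarefree p X u"
proof (rule tiles_squarefreeI[of X p y u])
  show "copies X p z" if "z \<notin> X" for z by (rule p_copies[OF that])
  show "y \<in> X" by (rule y(1))
  show "y \<le> x" if "x \<in> X" for x by (rule y(2)[OF that])
  show "0 < u" "u < y" using tail_ge2[OF u] mark_gt[OF y(1)] by auto
  show "p x \<noteq> p u" if "x \<in> X" for x using p_mark[OF that] p_tail[OF u] disj[OF that u] by simp
  show "\<not> suffix_square u (prefix_word p j)" if "j < y" for j by (rule prefix_squarefree[OF u that])
  show "\<not> suffix_square u (prefix_word p x @ prefix_word p j)"
    if "x \<in> X" "j < u" "2 * u \<le> x + j" for x j by (rule mark_squarefree[OF u that])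
qed

lemma p_coding: "coding X (m # T) c d p"
  unfolding coding_def
proof (intro conjI ballI allI impI)
  show "p x = c x" if "x \<in> X" for x by (rule p_mark[OF that])
  show "p t = d t" if "t \<in> set (m # T)" for t by (rule p_tail[OF that])
  show "copies X p z" if "z \<notin> X" for z by (rule p_copies[OF that])
  show "p z = p (z - t)" if "t \<in> set (m # T)" "t < z" "z < 2 * t" for t z by (rule p_per[OF that])
  show "p z \<in> c ` X \<union> d ` set (m # T)" if "0 < z" for z by (rule p_range[OF that])
  show "p (x' - x) \<noteq> c x'" if "x \<in> X" "x' \<in> X" "x < x'" for x x' by (rule p_diff[OF that])
  show "tiles_squarefree p X t" if "t \<in> set (m # T)" for t by (rule p_tiles[OF that])
qed

lemma final_letterI:
  assumes "b \<in> d ` set (m # T)" "b \<noteq> p (y - m) \<or> m + 1 < y \<and> p (y - 1) \<noteq> p (y - 1 - m)"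
    and "\<And>u. u \<in> set T \<Longrightarrow> b \<noteq> p (y - u) \<or> u + 1 < y \<and> p (y - 1) \<noteq> p (y - 1 - u)"
  shows "\<exists>b. final_letter y (m # T) d p b"
proof -
  have "final_letter y (m # T) d p b"
    unfolding final_letter_def
  proof (intro conjI ballI)
    fix u assume "u \<in> set (m # T)"
    then consider "u = m" | "u \<in> set T" by auto
    then show "b \<noteq> p (y - u) \<or> u + 1 < y \<and> p (y - 1) \<noteq> p (y - 1 - u)"
      by cases (use assms(2,3) in blast)+
  qed (rule assms(1))
  then show ?thesis by blast
qed

text \<open>\<open>d\<close> offers one letter more than \<open>T\<close> has lengths, so some
  \<open>b\<close> avoids every \<open>p (y - u)\<close> with \<open>u\<close> in \<open>T\<close>,
  and only \<open>u = m\<close> is at issue. For \<open>y < 2 * m\<close>,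
  \<open>p (y - m) = c y\<close> is not a \<open>d\<close> letter; for \<open>y > 2 * m\<close>, the
  free position \<open>y - 1\<close> gives the mismatch. For \<open>y = 2 * m\<close> the letter
  found for \<open>q\<close> at \<open>m\<close> works: it differs from \<open>d m\<close>, and
  \<open>p (y - v) = q (m - v)\<close> transfers its mismatches.\<close>

lemma p_final_letter:
  assumes X: "X = {y}" and nd: "\<not> doubling_list (y # m # T)"
    and IH: "y = 2 * m \<Longrightarrow> \<not> doubling_list (m # T) \<Longrightarrow> \<exists>b. final_letter m T d q b"
  shows "\<exists>b. final_letter y (m # T) d p b"
proof -
  have m2: "2 \<le> m" using sd by simp
  have my: "m < y" using mark_gt y(1) by simp
  have T_card: "card (d ` set (m # T)) = Suc (card (set T))"
  proof -
    have "m \<notin> set T" using tail_less by blast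
    then show ?thesis using card_image[OF inj_d] by simp
  qed
  have less: "card ((\<lambda>u. p (y - u)) ` set T) < card (d ` set (m # T))"
    using card_image_le[of "set T" "\<lambda>u. p (y - u)"] T_card by simp
  have "\<not> d ` set (m # T) \<subseteq> (\<lambda>u. p (y - u)) ` set T"
    using less card_mono[of "(\<lambda>u. p (y - u)) ` set T" "d ` set (m # T)"] by auto
  then obtain b where b: "b \<in> d ` set (m # T)" "b \<notin> (\<lambda>u. p (y - u)) ` set T" by blast
  consider "y < 2 * m" | "y = 2 * m" | "2 * m < y" by linarith
  then show ?thesis
  proof cases
    case 1
    have "p (y - m) = c y"
      using p_eq_q[of "y - m"] q_mark[of "y - m"] c'_low[OF y(1) 1] 1 by simp
    moreover obtain t where "t \<in> set (m # T)" "b = d t" using b(1) by blast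
    ultimately have "b \<noteq> p (y - m)" using disj[OF y(1), of t] by simp
    then show ?thesis using b by (intro final_letterI[of b]) blast+
  next
    case 2
    then have "\<not> doubling_list (m # T)" using nd by simp
    then obtain e where e: "e \<in> d ` set T"
      "\<And>u. u \<in> set T \<Longrightarrow> e \<noteq> q (m - u) \<or> u + 1 < m \<and> q (m - 1) \<noteq> q (m - 1 - u)"
      using IH[OF 2] unfolding final_letter_def by blast
    have "e \<noteq> p (y - m)"
    proof -
      obtain t where t: "t \<in> set T" "e = d t" using e(1) by blast
      have "d t \<noteq> d m" using inj_onD[OF inj_d, of t m] tail_less[OF t(1)] t(1) by auto
      moreover have "p (y - m) = d m" using p_tail[of m] 2 by simp
      ultimately show ?thesis using t(2) by simp
    qed
    moreover have "e \<noteq> p (y - u) \<or> u + 1 < y \<and> p (y - 1) \<noteq> p (y - 1 - u)" if u: "u \<in> set T" for u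
    proof -
      have shift: "p (y - v) = q (m - v)" if "0 < v" "v < m" for v
        using p_per[of m "y - v"] p_eq_q[of "m - v"] that 2 by simp
      have sh: "p (y - u) = q (m - u)" "p (y - 1) = q (m - 1)" "u + 1 < y"
        using shift[of u] shift[of 1] tail_less[OF u] m2 my by auto
      from e(2)[OF u] show ?thesis
      proof
        assume "u + 1 < m \<and> q (m - 1) \<noteq> q (m - 1 - u)"
        moreover from this have "p (y - 1 - u) = q (m - 1 - u)" using shift[of "1 + u"] by simp
        ultimately show ?thesis unfolding sh using sh(3) by presburger
      qed (simp add: sh(1))
    qed
    moreover have "e \<in> d ` set (m # T)" using e(1) by auto
    ultimately show ?thesis by (intro final_letterI[of e]) blast+
  next
    case 3
    have "p (y - 1) \<noteq> p (y - 1 - m)"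
      by (rule p_mismatch) (use 3 m2 in auto)
    moreover have "m + 1 < y" using 3 m2 by simp
    ultimately show ?thesis using b by (intro final_letterI[of b]) blast+
  qed
qed

end

section \<open>Existence of copying words and greedy fillings\<close>

text \<open>Recursion along the order of positions: \<open>p0\<close> is consulted only below all
  marks, and every other value is forced.\<close>

lemma ex_copying_extension:
  assumes pos: "\<And>x. x \<in> X \<Longrightarrow> (0::nat) < x"
  obtains p where "\<And>x. x \<in> X \<Longrightarrow> p x = c x" "\<And>z. z \<notin> X \<Longrightarrow> copies X p z"
    "\<And>z. z \<notin> X \<Longrightarrow> (\<And>x. x \<in> X \<Longrightarrow> z \<le> x) \<Longrightarrow> p z = p0 z"
proof -
  let ?max = "\<lambda>x z. x \<in> X \<and> x < z \<and> (\<forall>x'\<in>X. x' < z \<longrightarrow> x' \<le> x)"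
  define P where "P f z v \<longleftrightarrow> (if z \<in> X then v = c z
      else (\<forall>x. ?max x z \<longrightarrow> v = f (z - x)) \<and> ((\<forall>x\<in>X. z \<le> x) \<longrightarrow> v = p0 z))" for f z v
  have "\<exists>p. \<forall>z. P p z (p z)"
  proof (rule dependent_wf_choice[of less_than])
    fix f g :: "nat \<Rightarrow> 'a" and z v
    assume fg: "\<And>w. (w, z) \<in> less_than \<Longrightarrow> f w = g w"
    have "f (z - x) = g (z - x)" if "?max x z" for x
      using fg[of "z - x"] pos[of x] that by simp
    then have "(\<forall>x. ?max x z \<longrightarrow> v = f (z - x)) \<longleftrightarrow> (\<forall>x. ?max x z \<longrightarrow> v = g (z - x))" by metis
    then show "P f z v = P g z v" unfolding P_def by argo
  next
    fix z and f :: "nat \<Rightarrow> 'a"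
    show "\<exists>v. P f z v"
    proof (cases "z \<in> X \<or> (\<forall>x\<in>X. z \<le> x)")
      case True
      then have "P f z (if z \<in> X then c z else p0 z)" unfolding P_def by (auto simp: leD)
      then show ?thesis by blast
    next
      case False
      then obtain x0 where "x0 \<in> X" "x0 < z" by (auto simp: not_le)
      then obtain x where x: "?max x z" using max_below[of x0 X z] by metis
      have "x' = x" if "?max x' z" for x' using that x by (meson le_antisym)
      then have "\<forall>x'. ?max x' z \<longrightarrow> f (z - x) = f (z - x')" by blast
      then have "P f z (f (z - x))" unfolding P_def using False by argo
      then show ?thesis by blast
    qed
  qed simp
  then obtain p where p: "\<And>z. P p z (p z)" by blast
  show ?thesis
  proof (rule that[of p])
    show "p x = c x" if "x \<in> X" for x using p[of x] that by (simp add: P_def)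
    show "copies X p z" if "z \<notin> X" for z
    proof (rule copiesI)
      fix x assume "x \<in> X" "x < z" "\<And>x'. x' \<in> X \<Longrightarrow> x' < z \<Longrightarrow> x' \<le> x"
      then have "?max x z" by blast
      then show "p z = p (z - x)" using p[of z] that unfolding P_def by metis
    qed
    show "p z = p0 z" if "z \<notin> X" "\<And>x. x \<in> X \<Longrightarrow> z \<le> x" for z
      using p[of z] that unfolding P_def by metis
  qed
qed

lemma ex_free_fill:
  fixes d q :: "nat \<Rightarrow> 'a"
  assumes T: "distinct T" "\<And>u. u \<in> set T \<Longrightarrow> 0 < u" and m: "0 < m"
    and inj: "inj_on d (set T)" "e \<notin> d ` set T"
  obtains p where "\<And>z. z < 2 * m \<Longrightarrow> p z = q z"
    "\<And>z. 2 * m \<le> z \<Longrightarrow> p z \<in> insert e (d ` set T)"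
    "\<And>z u. 2 * m \<le> z \<Longrightarrow> u \<in> set T \<Longrightarrow> z = 2 * m \<or> z + u \<noteq> y \<Longrightarrow> p z \<noteq> p (z - u)"
    "\<And>z u. 2 * m < z \<Longrightarrow> u \<in> set T \<Longrightarrow> z + u = y \<Longrightarrow> p z \<noteq> e"
proof -
  define P where "P f z v \<longleftrightarrow> (if z < 2 * m then v = q z else v \<in> insert e (d ` set T) \<and>
      (\<forall>u\<in>set T. z = 2 * m \<or> z + u \<noteq> y \<longrightarrow> v \<noteq> f (z - u)) \<and>
      (\<forall>u\<in>set T. 2 * m < z \<longrightarrow> z + u = y \<longrightarrow> v \<noteq> e))" for f z v
  have card: "card (insert e (d ` set T)) = Suc (card (set T))"
    using inj by (simp add: card_image)
  have pick: "\<exists>v. v \<in> insert e (d ` set T) \<and> v \<notin> B" if "finite B" "card B \<le> card (set T)" for B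
  proof -
    have "\<not> insert e (d ` set T) \<subseteq> B" using card card_mono[of B "insert e (d ` set T)"] that by auto
    then show ?thesis by blast
  qed
  have "\<exists>p. \<forall>z. P p z (p z)"
  proof (rule dependent_wf_choice[of less_than])
    fix f g :: "nat \<Rightarrow> 'a" and z v
    assume fg: "\<And>w. (w, z) \<in> less_than \<Longrightarrow> f w = g w"
    have "f (z - u) = g (z - u)" if "u \<in> set T" "2 * m \<le> z" for u
      using fg[of "z - u"] T(2)[of u] m that by simp
    then have fg': "2 * m \<le> z \<Longrightarrow> (\<forall>u\<in>set T. z = 2 * m \<or> z + u \<noteq> y \<longrightarrow> v \<noteq> f (z - u)) \<longleftrightarrow>
        (\<forall>u\<in>set T. z = 2 * m \<or> z + u \<noteq> y \<longrightarrow> v \<noteq> g (z - u))" by simp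
    show "P f z v = P g z v"
    proof (cases "z < 2 * m")
      case True
      then show ?thesis by (simp only: P_def if_True)
    next
      case False
      then show ?thesis using fg' by (simp only: P_def if_False not_less)
    qed
  next
    fix z and f :: "nat \<Rightarrow> 'a"
    consider "z < 2 * m" | u where "2 * m < z" "u \<in> set T" "z + u = y"
      | "2 * m \<le> z" "\<And>u. u \<in> set T \<Longrightarrow> z = 2 * m \<or> z + u \<noteq> y" by (metis nat_neq_iff not_le)
    then show "\<exists>v. P f z v"
    proof cases
      case 1
      then show ?thesis by (simp add: P_def)
    next
      case (2 u)
      \<comment> \<open>\<open>e\<close> takes the place of the dropped letter
        \<open>f (z - u)\<close>, so the number of forbidden letters does not grow and one letter
        remains.\<close>
      let ?B = "insert e ((\<lambda>u. f (z - u)) ` (set T - {u}))"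
      have "card ?B \<le> Suc (card ((\<lambda>u. f (z - u)) ` (set T - {u})))" by (simp add: card_insert_if)
      also have "\<dots> \<le> Suc (card (set T - {u}))"
        by (intro Suc_le_mono[THEN iffD2] card_image_le) simp
      also have "\<dots> = card (set T)" by (rule card_Suc_Diff1[OF List.finite_set 2(2)])
      finally have le: "card ?B \<le> card (set T)" .
      obtain v where v: "v \<in> insert e (d ` set T)" "v \<notin> ?B" using pick[OF _ le] by auto
      have "v \<noteq> f (z - u')" if "u' \<in> set T" "z + u' \<noteq> y" for u'
      proof -
        have "u' \<in> set T - {u}" using that 2(3) by auto
        then show ?thesis using v(2) by (metis imageI insertI2)
      qed
      moreover have "v \<noteq> e" using v(2) by simp
      ultimately have "P f z v" using v(1) 2(1) unfolding P_def by simp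
      then show ?thesis by blast
    next
      case 3
      have "card ((\<lambda>u. f (z - u)) ` set T) \<le> card (set T)" by (simp add: card_image_le)
      then obtain v where v: "v \<in> insert e (d ` set T)" "v \<notin> (\<lambda>u. f (z - u)) ` set T"
        using pick[of "(\<lambda>u. f (z - u)) ` set T"] by auto
      have "v \<noteq> f (z - u)" if "u \<in> set T" for u using v(2) imageI[OF that, of "\<lambda>u. f (z - u)"] by metis
      moreover have "\<not> (2 * m < z \<and> z + u = y)" if "u \<in> set T" for u using 3(2)[OF that] by auto
      ultimately have "P f z v" using v(1) 3(1) unfolding P_def by (metis not_le)
      then show ?thesis by blast
    qed
  qed simp
  then obtain p where p: "\<And>z. P p z (p z)" by blast
  show ?thesis
  proof (rule that[of p])
    show "p z = q z" if "z < 2 * m" for z using p[of z] that by (simp add: P_def)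
    show "p z \<in> insert e (d ` set T)" if "2 * m \<le> z" for z
      using p[of z] that unfolding P_def by (metis not_le)
    show "p z \<noteq> p (z - u)" if "2 * m \<le> z" "u \<in> set T" "z = 2 * m \<or> z + u \<noteq> y" for z u
      using p[of z] that unfolding P_def by (metis not_le)
    show "p z \<noteq> e" if "2 * m < z" "u \<in> set T" "z + u = y" for z u
      using p[of z] that unfolding P_def by (metis less_imp_le not_le)
  qed
qed

lemma ex_coding_no_tail:
  assumes mk: "marking X [] c d"
  shows "\<exists>p. coding X [] c d p"
proof -
  define y where "y = Min X"
  have pos: "0 < x" if "x \<in> X" for x
    using mk that by (auto simp: marking_def)
  have fin: "finite X" "X \<noteq> {}" and inj: "inj_on c X" using mk by (auto simp: marking_def)
  have y: "y \<in> X" "\<And>x. x \<in> X \<Longrightarrow> y \<le> x" using fin by (auto simp: y_def)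
  \<comment> \<open>Below \<open>y\<close> the word is constantly \<open>c y\<close>, a letter that
    the clause on \<open>p (x' - x)\<close> never forbids, since
    \<open>x' > x \<ge> y\<close>.\<close>
  obtain p where p: "\<And>x. x \<in> X \<Longrightarrow> p x = c x" "\<And>z. z \<notin> X \<Longrightarrow> copies X p z"
    "\<And>z. z \<notin> X \<Longrightarrow> (\<And>x. x \<in> X \<Longrightarrow> z \<le> x) \<Longrightarrow> p z = c y"
    using ex_copying_extension[of X c "\<lambda>_. c y"] pos by blast
  have range: "p z \<in> c ` X \<and> (\<forall>x\<in>X. x \<noteq> y \<longrightarrow> z < x \<longrightarrow> p z \<noteq> c x)" if "0 < z" for z
    using that
  proof (induction z rule: less_induct)
    case (less z)
    consider "z \<in> X" | "z \<notin> X" "z < y" | "z \<notin> X" "y < z" using y(1) by (metis nat_neq_iff)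
    then show ?case
    proof cases
      case 1
      then show ?thesis using p(1) inj_onD[OF inj, of z] by auto
    next
      case 2
      have "p z = c y" by (rule p(3)[OF 2(1)]) (use 2 y(2) in force)
      then show ?thesis using y(1) inj_onD[OF inj, of y] by auto
    next
      case 3
      obtain x where x: "x \<in> X" "x < z" "\<And>x'. x' \<in> X \<Longrightarrow> x' < z \<Longrightarrow> x' \<le> x"
        using max_below[OF y(1) 3(2)] by metis
      have pz: "p z = p (z - x)" using copiesD[OF p(2)[OF 3(1)] x] .
      have "0 < z - x" "z - x < z" using x pos[OF x(1)] by auto
      then show ?thesis using less.IH[of "z - x"] unfolding pz by auto
    qed
  qed
  have "p (x' - x) \<noteq> c x'" if "x \<in> X" "x' \<in> X" "x < x'" for x x'
    using range[of "x' - x"] that y(2)[of x] pos[of x] by auto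
  then have "coding X [] c d p" using p(1,2) range by (simp add: coding_def)
  then show ?thesis by blast
qed

lemma ex_coding:
  assumes "marking X T c d"
  shows "\<exists>p. coding X T c d p \<and> (\<forall>y. X = {y} \<and> \<not> doubling_list (y # T) \<longrightarrow> (\<exists>b. final_letter y T d p b))"
  using assms
proof (induction T arbitrary: X c)
  case Nil
  then show ?case using ex_coding_no_tail[of X c d] by auto
next
  case (Cons m T)
  let ?X' = "step_marks X m" and ?c' = "step_letters m c d"
  obtain q where q: "coding ?X' T ?c' d q"
    "\<And>y. ?X' = {y} \<Longrightarrow> \<not> doubling_list (y # T) \<Longrightarrow> \<exists>b. final_letter y T d q b"
    using Cons.IH[OF marking_step[OF Cons.prems]] by blast
  define y where "y = Min X"
  note mk = Cons.prems[unfolded marking_def]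
  have y: "y \<in> X" "\<And>x. x \<in> X \<Longrightarrow> y \<le> x" using mk by (auto simp: y_def)
  have T: "distinct (m # T)" "\<And>u. u \<in> set (m # T) \<Longrightarrow> 0 < u"
  proof -
    have "distinct T'" if "superdecreasing T'" for T'
      using that
    proof (induction T')
      case (Cons t T')
      then have "t \<notin> set T'" using superdecreasing_mem(2)[of T' t] by auto
      then show ?case using Cons by simp
    qed simp
    then show "distinct (m # T)" using mk by blast
    show "0 < u" if "u \<in> set (m # T)" for u using superdecreasing_mem(1)[OF _ that] mk by simp
  qed
  obtain p0 where p0: "\<And>z. z < 2 * m \<Longrightarrow> p0 z = q z"
    "\<And>z. 2 * m \<le> z \<Longrightarrow> p0 z \<in> insert (c y) (d ` set (m # T))"
    "\<And>z u. 2 * m \<le> z \<Longrightarrow> u \<in> set (m # T) \<Longrightarrow> z = 2 * m \<or> z + u \<noteq> y \<Longrightarrow> p0 z \<noteq> p0 (z - u)"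
    "\<And>z u. 2 * m < z \<Longrightarrow> u \<in> set (m # T) \<Longrightarrow> z + u = y \<Longrightarrow> p0 z \<noteq> c y"
  proof (rule ex_free_fill[of "m # T" m d "c y" q y, OF T])
    show "c y \<notin> d ` set (m # T)" using mk y(1) by blast
  qed (use mk T in auto)
  have pos: "0 < x" if "x \<in> X" for x using mk that by fastforce
  obtain p where p: "\<And>x. x \<in> X \<Longrightarrow> p x = c x" "\<And>z. z \<notin> X \<Longrightarrow> copies X p z"
    and p_below: "\<And>z. z \<notin> X \<Longrightarrow> (\<And>x. x \<in> X \<Longrightarrow> z \<le> x) \<Longrightarrow> p z = p0 z"
    using ex_copying_extension[of X c p0] pos by blast
  have low: "p z = p0 z" if "z < y" for z
  proof (rule p_below)
    show "z \<notin> X" using y(2)[of z] that by linarith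
    show "z \<le> x" if "x \<in> X" for x using y(2)[OF that] \<open>z < y\<close> by linarith
  qed
  interpret extension_step X m T c d q p y
  proof
    show "p z = q z" if "z < 2 * m" "z < y" for z using low p0(1) that by simp
    show "p z \<in> insert (c y) (d ` set (m # T))" if "2 * m \<le> z" "z < y" for z
      using low[OF that(2)] p0(2)[OF that(1)] by simp
    show "p z \<noteq> p (z - u)" if "2 * m \<le> z" "z < y" "u \<in> set (m # T)" "z = 2 * m \<or> z + u \<noteq> y" for z u
      using low[of z] low[of "z - u"] p0(3)[of z u] that by simp
    show "p z \<noteq> c y" if "2 * m < z" "z < y" "u \<in> set (m # T)" "z + u = y" for z u
      using low[of z] p0(4)[of z u] that by simp
    show "marking X (m # T) c d" by (rule Cons.prems)
    show "coding ?X' T ?c' d q" by (rule q(1))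
    show "y \<in> X" by (rule y(1))
    show "y \<le> x" if "x \<in> X" for x by (rule y(2)[OF that])
    show "p x = c x" if "x \<in> X" for x by (rule p(1)[OF that])
    show "copies X p z" if "z \<notin> X" for z by (rule p(2)[OF that])
  qed
  have "\<exists>b. final_letter y' (m # T) d p b" if X: "X = {y'}" "\<not> doubling_list (y' # m # T)" for y'
  proof -
    have y': "y' = y" using X(1) y(1) by simp
    have "\<exists>b. final_letter m T d q b" if "y = 2 * m" "\<not> doubling_list (m # T)"
      by (rule q(2)[OF _ that(2)]) (use that(1) X(1) y' in \<open>simp add: step_marks_def\<close>)
    then show ?thesis using p_final_letter X unfolding y' by blast
  qed
  then show ?case using p_coding by blast
qed

subsection \<open>Existence of dead ends\<close>

lemma squarefree_len_rev [simp]: "squarefree_len m (rev w) \<longleftrightarrow> squarefree_len m w"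
proof -
  have "squarefree_len m (rev w)" if s: "squarefree_len m w" for w :: "'a list"
    unfolding squarefree_len_def
  proof
    assume "\<exists>x v y. rev w = x @ v @ v @ y \<and> length v = m"
    then obtain x v y where v: "rev w = x @ v @ v @ y" "length v = m" by auto
    have "w = rev (rev w)" by simp
    also have "\<dots> = rev y @ rev v @ rev v @ rev x" unfolding v(1) by simp
    finally show False using s v(2) unfolding squarefree_len_def by (metis length_rev)
  qed
  from this[of w] this[of "rev w"] show ?thesis by auto
qed

lemma take_prefix_word: "k \<le> n \<Longrightarrow> take k (prefix_word p n) = prefix_word p k"
  by (rule nth_equalityI) auto

text \<open>Position \<open>2 * y\<close> of \<open>p\<close> repeats position \<open>y\<close> and
  would complete a square of length \<open>i 1\<close>; it is overwritten by \<open>b\<close>. This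
  is the first letter of the reversed word, which \<open>tl\<close> removes, so the squares
  completed by appending a letter are not affected.\<close>

lemma dead_end_exists:
  fixes A :: "'a set"
  assumes fin: "finite A" and card: "card A = r" and seq: "increasing_seq r i"
    and two: "2 \<le> r" "2 \<le> i r" and nd: "\<not> doubling_seq r i" and ns: "\<not> has_small_term r i"
  shows "\<exists>w. dead_end A r i w"
proof -
  have ge2: "2 \<le> i t" if "t \<in> {1..r}" for t
  proof (cases "t = r")
    case False
    then show ?thesis using increasing_seq_less[OF seq, of t r] that two by simp
  qed (use two in simp)
  have inj_i: "inj_on i {1..r}"
    by (rule linorder_inj_onI) (use increasing_seq_less[OF seq] in force)+
  define L where "L s = map i [s..<Suc r]" for s
  have L_Cons: "L s = i s # L (Suc s)" if "s \<le> r" for s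
    using that by (simp add: L_def upt_rec del: upt_Suc)
  have set_L: "set (L s) = i ` {s..r}" for s
    by (simp add: L_def atLeastLessThanSuc_atLeastAtMost del: upt_Suc)
  have sum_L: "sum_list (L s) = (\<Sum>u = s..r. i u)" for s
    by (simp add: L_def interv_sum_list_conv_sum_set_nat atLeastLessThanSuc_atLeastAtMost del: upt_Suc)
  have sum_less: "sum_list (L (Suc s)) < i s" if s: "1 \<le> s" "s \<le> r" for s
  proof -
    \<comment> \<open>\<open>has_small_term\<close> is silent about the last two indices; there the
      bound is just \<open>i r < i (r - 1)\<close> and \<open>0 < i r\<close>.\<close>
    consider "s < r - 1" | "s = r - 1" | "s = r" using s by linarith
    then show ?thesis
    proof cases
      case 1
      then show ?thesis using ns s by (auto simp: sum_L has_small_term_def not_le)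
    next
      case 2
      then have "Suc s = r" using two by simp
      then show ?thesis using increasing_seq_less[OF seq, of s r] s by (simp add: sum_L)
    next
      case 3
      then show ?thesis using ge2[of s] s by (simp add: sum_L)
    qed
  qed
  have sd: "superdecreasing (L s)" if "1 \<le> s" "s \<le> Suc r" for s
    using that(2,1)
  proof (induction s rule: inc_induct)
    case base
    then show ?case by (simp add: L_def)
  next
    case (step s)
    then show ?case using L_Cons[of s] ge2[of s] sum_less[of s] by simp
  qed
  have dbl: "\<forall>t\<in>{s..r}. i t = 2 ^ (r - t) * i r" if "s \<le> r" "doubling_list (L s)" for s
    using that
  proof (induction s rule: inc_induct)
    case base
    then show ?case by simp
  next
    case (step s)
    have sr: "s \<le> r" "Suc s \<le> r" using step.hyps by auto
    have "L s = i s # i (Suc s) # L (Suc (Suc s))"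
      unfolding L_Cons[OF sr(1)] L_Cons[OF sr(2)] by (rule refl)
    then have "doubling_list (i s # i (Suc s) # L (Suc (Suc s)))" using step.prems by metis
    then have s: "i s = 2 * i (Suc s)" "doubling_list (L (Suc s))"
      unfolding L_Cons[OF sr(2)] by simp_all
    have IH: "i t = 2 ^ (r - t) * i r" if "t \<in> {Suc s..r}" for t
      using step.IH[OF s(2)] that by blast
    have "i s = 2 * (2 ^ (r - Suc s) * i r)" using s(1) IH[of "Suc s"] sr by simp
    moreover have "r - s = Suc (r - Suc s)" using sr by simp
    ultimately have "i s = 2 ^ (r - s) * i r" by (simp only: power_Suc mult.assoc)
    then show ?case using IH by (metis atLeastAtMost_iff le_antisym not_less_eq_eq)
  qed
  obtain g where g: "bij_betw g {1..r} A"
    using finite_same_card_bij[of "{1..r}" A] fin card by auto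
  define h where "h z = g (the_inv_into {1..r} i z)" for z
  have h_i: "h (i t) = g t" if "t \<in> {1..r}" for t
    using the_inv_into_f_f[OF inj_i that] by (simp add: h_def)
  have inj_h: "inj_on h (i ` {1..r})"
  proof (rule inj_onI)
    fix a b assume "a \<in> i ` {1..r}" "b \<in> i ` {1..r}" and hab: "h a = h b"
    then obtain s t where st: "s \<in> {1..r}" "t \<in> {1..r}" "a = i s" "b = i t" by blast
    then have "g s = g t" using hab h_i by simp
    then have "s = t" using inj_onD[OF bij_betw_imp_inj_on[OF g]] st by blast
    then show "a = b" using st by simp
  qed
  have h_A: "h ` i ` {1..r} = A"
  proof -
    have "h ` i ` {1..r} = g ` {1..r}" unfolding image_image by (rule image_cong) (use h_i in auto)
    then show ?thesis using bij_betw_imp_surj_on[OF g] by simp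
  qed
  define y where "y = i 1"
  define T where "T = L (Suc 1)"
  have yT: "L 1 = y # T" using L_Cons[of 1] two by (simp add: y_def T_def)
  have sd_yT: "superdecreasing (y # T)" using sd[of 1] two unfolding yT by simp
  have set_yT: "insert y (set T) = i ` {1..r}" using set_L[of 1] unfolding yT by simp
  have y_notin: "y \<notin> set T"
    using superdecreasing_mem(2)[of T y] sd_yT by auto
  have mk: "marking {y} T h h"
    unfolding marking_def
  proof (intro conjI)
    show "superdecreasing T" "\<forall>x\<in>{y}. sum_list T < x" using sd_yT by auto
    show "inj_on h (set T)" by (rule inj_on_subset[OF inj_h]) (use set_yT in auto)
    have "h y \<noteq> h t" if "t \<in> set T" for t
      using inj_onD[OF inj_h, of y t] that set_yT y_notin by auto
    then show "h ` {y} \<inter> h ` set T = {}" by auto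
  qed auto
  have "\<not> doubling_list (y # T)"
    using dbl[of 1] two nd unfolding yT doubling_seq_def by linarith
  then obtain p b where p: "coding {y} T h h p" and b: "final_letter y T h p b"
    using ex_coding[OF mk] by blast
  note p_simps = p[unfolded coding_def]
  have p_letter: "p (i t) = h (i t)" if "t \<in> {1..r}" for t
  proof -
    have "i t \<in> insert y (set T)" using set_yT that by blast
    then show ?thesis using p_simps[THEN conjunct1] p_simps[THEN conjunct2, THEN conjunct1] by blast
  qed
  have copy_y: "p z = p (z - y)" if "y < z" for z
    by (rule copiesD[of "{y}"]) (use p_simps[THEN conjunct2, THEN conjunct2, THEN conjunct1] that in auto)
  have per: "p z = p (z - i t)" if "t \<in> {1..r}" "i t < z" "z < 2 * i t" for t z
  proof (cases "i t = y")
    case False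
    then have "i t \<in> set T" using set_yT that(1) by blast
    then show ?thesis
      using p_simps[THEN conjunct2, THEN conjunct2, THEN conjunct2, THEN conjunct1] that(2,3) by blast
  qed (use copy_y that in simp)
  have p_A: "p z \<in> A" if "0 < z" for z
  proof -
    have "p z \<in> h ` {y} \<union> h ` set T"
      using p_simps[THEN conjunct2, THEN conjunct2, THEN conjunct2, THEN conjunct2, THEN conjunct1] that by blast
    also have "\<dots> = h ` insert y (set T)" by auto
    finally show ?thesis using h_A set_yT by simp
  qed
  have tiles: "tiles_squarefree p {y} u" if "u \<in> set T" for u
    using p that unfolding coding_def by blast
  have b_T: "b \<in> h ` set T" and b_mis: "u \<in> set T \<Longrightarrow> b \<noteq> p (y - u) \<or> u + 1 < y \<and> p (y - 1) \<noteq> p (y - 1 - u)" for u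
    using b unfolding final_letter_def by blast+
  have b_A: "b \<in> A"
  proof -
    have "h ` set T \<subseteq> h ` i ` {1..r}" by (rule image_mono) (use set_yT in auto)
    then show ?thesis using b_T h_A by blast
  qed
  have b_y: "b \<noteq> p y"
  proof -
    obtain t where t: "t \<in> set T" "b = h t" using b_T by blast
    have "p y = h y" using p_letter[of 1] two by (simp add: y_def)
    moreover have "h y \<noteq> h t" using mk t(1) unfolding marking_def by blast
    ultimately show ?thesis using t(2) by simp
  qed
  have y_ge: "2 \<le> y" using ge2[of 1] two by (simp add: y_def)
  have T_bounds: "2 \<le> u" "u < y" if "u \<in> set T" for u
    using that superdecreasing_mem[of T u] sd_yT by auto
  let ?N = "2 * y"
  let ?p' = "p(?N := b)"
  let ?w = "rev (prefix_word ?p' ?N)"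
  have low: "prefix_word ?p' n = prefix_word p n" if "n < ?N" for n
    by (rule prefix_word_cong) (use that in auto)
  have sqf: "squarefree_len u ?w" if u: "u \<in> insert y (set T)" for u
  proof -
    have False if n: "n \<le> ?N" and sq: "suffix_square u (prefix_word ?p' n)" for n
    proof (cases "n < ?N")
      case True
      then have "u \<noteq> y" using sq by (auto simp: suffix_square_iff)
      then have "tiles_squarefree p {y} u" using tiles u by simp
      then have "\<not> suffix_square u (concat (map (prefix_word p) []) @ prefix_word p n)"
        unfolding tiles_squarefree_def by (metis empty_set empty_subsetI)
      then show False using sq low[OF True] by simp
    next
      case False
      note mm = suffix_square_prefix_word[OF sq]
      have nN: "n = ?N" using n False by simp
      show False
      proof (cases "u = y")
        case True
        then show False using mm(2)[of ?N] nN b_y y_ge by simp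
      next
        case False
        then have uT: "u \<in> set T" using u by simp
        have "?N - u \<noteq> ?N" using T_bounds[OF uT] by simp
        then have "b = p (?N - u)" using mm(2)[of ?N] nN T_bounds[OF uT] by simp
        also have "\<dots> = p (y - u)" using copy_y[of "?N - u"] T_bounds[OF uT] by simp
        finally have bu: "u + 1 < y" "p (y - 1) \<noteq> p (y - 1 - u)" using b_mis[OF uT] by auto
        have "?N - u < ?N - 1" "?N - 1 \<noteq> ?N" "?N - 1 - u \<noteq> ?N" using T_bounds[OF uT] by auto
        then have "p (?N - 1) = p (?N - 1 - u)" using mm(2)[of "?N - 1"] nN by simp
        moreover have "p (?N - 1) = p (y - 1)" using copy_y[of "?N - 1"] y_ge by simp
        moreover have "p (?N - 1 - u) = p (y - 1 - u)" using copy_y[of "?N - 1 - u"] bu(1) by simp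
        ultimately show False using bu(2) by simp
      qed
    qed
    then show ?thesis unfolding squarefree_len_rev unfolding squarefree_len_iff_take length_prefix_word
      by (metis take_prefix_word)
  qed
  have square: "\<exists>t\<in>{1..r}. \<exists>x v. tl ?w @ [a] = x @ v @ v \<and> length v = i t" if a: "a \<in> A" for a
  proof -
    obtain t where t: "t \<in> {1..r}" "a = p (i t)" using a p_letter unfolding h_A[symmetric] by auto
    let ?U = "tl ?w @ [a]"
    have it: "2 \<le> i t" "i t \<le> y"
      using ge2[OF t(1)] increasing_seq_less[OF seq, of 1 t] t(1) by (auto simp: y_def le_less)
    have len: "length ?U = ?N" using y_ge by simp
    have U1: "?U ! (?N - 1) = a" using y_ge by (simp add: nth_append)
    have U: "?U ! (?N - Suc k) = p k" if "1 \<le> k" "k < ?N" for k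
    proof -
      have "?N - Suc k < length (tl ?w)" using that by simp
      then have "?U ! (?N - Suc k) = ?w ! (Suc (?N - Suc k))" by (simp only: nth_append nth_tl if_True)
      also have "Suc (?N - Suc k) = ?N - k" using that by simp
      also have "?w ! (?N - k) = prefix_word ?p' ?N ! (?N - Suc (?N - k))"
        using that by (simp add: rev_nth)
      also have "?N - Suc (?N - k) = k - 1" using that by simp
      also have "prefix_word ?p' ?N ! (k - 1) = p k" using that by simp
      finally show ?thesis .
    qed
    have "?U ! (?N - k) = ?U ! (?N - i t - k)" if k: "k \<in> {1..i t}" for k
    proof -
      have e: "?N - i t - k = ?N - Suc (i t + (k - 1))" using k by simp
      have r: "?U ! (?N - i t - k) = p (i t + (k - 1))"
        unfolding e by (rule U) (use k it in auto)
      show ?thesis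
      proof (cases "k = 1")
        case True
        then show ?thesis using r U1 t(2) by simp
      next
        case False
        then have "1 \<le> k - 1" "k - 1 < ?N" "Suc (k - 1) = k" using k it y_ge by auto
        then have "?U ! (?N - k) = p (k - 1)" using U[of "k - 1"] by simp
        moreover have "p (i t + (k - 1)) = p (k - 1)"
        proof -
          have "i t < i t + (k - 1)" "i t + (k - 1) < 2 * i t" using k False by auto
          from per[OF t(1) this] show ?thesis by simp
        qed
        ultimately show ?thesis using r by simp
      qed
    qed
    then have "suffix_square (i t) ?U" unfolding suffix_square_iff len using it by auto
    then show ?thesis using t(1) unfolding suffix_square_def by blast
  qed
  have "set ?w \<subseteq> A"
  proof
    fix a assume "a \<in> set ?w"
    then have "a \<in> ?p' ` {1..<Suc ?N}" by (simp only: prefix_word_def set_rev set_map set_upt)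
    then obtain z where "z \<in> {1..<Suc ?N}" "a = ?p' z" by blast
    then show "a \<in> A" using p_A[of z] b_A by (cases "z = ?N") auto
  qed
  moreover have "squarefree_seq r i ?w"
    unfolding squarefree_seq_def using sqf set_yT by blast
  ultimately have "dead_end A r i ?w"
    unfolding dead_end_def using square by (simp add: y_def)
  then show ?thesis by blast
qed

lemma doubling_seq_cong:
  assumes "\<And>t. t \<in> {1..r} \<Longrightarrow> i t = i' t" "1 \<le> r"
  shows "doubling_seq r i \<longleftrightarrow> doubling_seq r i'"
  using assms by (simp add: doubling_seq_def)

lemma has_small_term_cong:
  assumes "\<And>t. t \<in> {1..r} \<Longrightarrow> i t = i' t"
  shows "has_small_term r i \<longleftrightarrow> has_small_term r i'"
proof -
  have "(\<Sum>u = t + 1..r. i u) = (\<Sum>u = t + 1..r. i' u)" for t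
    by (rule sum.cong) (use assms in auto)
  moreover have "i t = i' t" if "0 < t" "t < r - 1" for t using assms[of t] that by simp
  ultimately show ?thesis unfolding has_small_term_def by metis
qed

theorem theorem1p1:
  fixes A :: "'a set" and l r :: nat and i :: "nat \<Rightarrow> nat"
  assumes "finite A" and "card A = l" and "l > 1"
    and "increasing_seq r i"
  shows "(r < l \<longrightarrow> no_dead_ends A r i)
    \<and> (r = l \<longrightarrow>
         (i r \<ge> 2 \<longrightarrow> (no_dead_ends A r i \<longleftrightarrow> doubling_seq r i \<or> has_small_term r i))
       \<and> (i r = 1 \<longrightarrow> (doubling_seq r i \<or> has_small_term r i \<longrightarrow> no_dead_ends A r i)))
    \<and> (r > l \<longrightarrow>
         (\<forall>j. index_choice l r j \<longrightarrow>
                doubling_seq l (\<lambda>k. i (j k)) \<or> has_small_term l (\<lambda>k. i (j k)))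
         \<longrightarrow> no_dead_ends A r i)"
proof (intro conjI impI)
  assume "r < l"
  show "no_dead_ends A r i"
    unfolding no_dead_ends_def
  proof
    assume "\<exists>w. dead_end A r i w"
    then obtain j where j: "index_choice l r j" using dead_end_subsequence[OF assms] by blast
    then have "card {1..l} \<le> card {1..r}"
      unfolding index_choice_def by (intro card_inj_on_le[of j] strict_mono_on_imp_inj_on) auto
    then show False using \<open>r < l\<close> by simp
  qed
next
  have sufficient: "no_dead_ends A r i" if "r = l" "doubling_seq r i \<or> has_small_term r i"
    unfolding no_dead_ends_def
  proof
    assume "\<exists>w. dead_end A r i w"
    then obtain j where j: "index_choice l r j"
      "\<not> doubling_seq l (\<lambda>k. i (j k))" "\<not> has_small_term l (\<lambda>k. i (j k))"
      using dead_end_subsequence[OF assms] by metis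
    have "i (j t) = i t" if "t \<in> {1..l}" for t
      using strict_mono_on_self[of l j t] j(1) that \<open>r = l\<close> by (simp add: index_choice_def)
    then have "\<not> doubling_seq l i" "\<not> has_small_term l i"
      using j(2,3) doubling_seq_cong[of l "\<lambda>k. i (j k)" i] has_small_term_cong[of l "\<lambda>k. i (j k)" i]
        \<open>l > 1\<close> by auto
    then show False using that by simp
  qed
  show "no_dead_ends A r i" if "r = l" "i r = 1" "doubling_seq r i \<or> has_small_term r i"
    using sufficient that by blast
  show "no_dead_ends A r i \<longleftrightarrow> doubling_seq r i \<or> has_small_term r i" if "r = l" "2 \<le> i r"
  proof
    assume "no_dead_ends A r i"
    then show "doubling_seq r i \<or> has_small_term r i"
      using dead_end_exists[of A r i] assms that unfolding no_dead_ends_def by auto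
  qed (use sufficient that in blast)
next
  assume "r > l" and all: "\<forall>j. index_choice l r j \<longrightarrow>
    doubling_seq l (\<lambda>k. i (j k)) \<or> has_small_term l (\<lambda>k. i (j k))"
  show "no_dead_ends A r i"
    unfolding no_dead_ends_def using dead_end_subsequence[OF assms] all by metis
qed

end
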